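(* Let $\mu,\mu',\nu,\nu'\in\mathcal M$ satisfy $\mu\preceq_{C,+}\nu$, $\mu'\preceq_{C,+}\nu'$, $\mu(\mathbb R)=\mu'(\mathbb R)$ and $\nu(\mathbb R)=\nu'(\mathbb R)$. Then $$W\big(S^{\nu}(\mu),S^{\nu'}(\mu')\big)\le W(\mu,\mu')+2\,W(\nu,\nu').$$
   Context: $\mathcal M$ is the set of finite positive Borel measures on $\mathbb R$ with finite first moment. For $\mu,\nu\in\mathcal M$ of the same mass, $W(\mu,\nu)=\sup_f\left|\int f\,d\mu-\int f\,d\nu\right|$, the supremum being over all $1$-Lipschitz functions $f:\mathbb R\to\mathbb R$ (Kantorovich distance). Orders on $\mathcal M$: $\mu\preceq_C\nu$ means $\int\varphi\,d\mu\le\int\varphi\,d\nu$ for every convex $\varphi:\mathbb R\to\mathbb R$ growing at most linearly at $\pm\infty$; $\mu\preceq_{C,+}\nu$ means the same inequality for every such $\varphi$ that is convex and non-negative; $\mu\preceq_+\nu$ means $\mu(B)\le\nu(B)$ for all Borel $B$. Shadow: if $\mu\preceq_{C,+}\nu$, there is a unique measure $\eta$ such that $\mu\preceq_C\eta$, $\eta\preceq_+\nu$, and $\eta\preceq_C\eta'$ for every $\eta'$ with $\mu\preceq_C\eta'\preceq_+\nu$. This $\eta$ is called the shadow of $\mu$ in $\nu$ and is denoted $S^\nu(\mu)$ (existence and uniqueness are known). *)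

theory Defs
  imports "HOL-Analysis.Analysis"
begin

definition first_moment_measures :: "real measure set" where
  "first_moment_measures =
     {\<mu>. sets \<mu> = sets borel \<and> finite_measure \<mu> \<and> integrable \<mu> (\<lambda>x. x)}"

definition linear_growth :: "(real \<Rightarrow> real) \<Rightarrow> bool" where
  "linear_growth \<phi> \<longleftrightarrow> (\<exists>a b. \<forall>x. \<bar>\<phi> x\<bar> \<le> a + b * \<bar>x\<bar>)"

text \<open>
  The Kantorovich distance and the orders below are meant for members of
  \<^const>\<open>first_moment_measures\<close> only; the distance moreover for measures of equal mass. Then every
  integral that occurs exists and the supremum is over a set that is bounded above, so that
  neither the Bochner integral nor the real-valued supremum takes a default value; see
  \<open>integrable_lipschitz\<close>, \<open>integrable_convex_linear_growth\<close> and \<open>bdd_above_kantorovich\<close>.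
\<close>

definition kantorovich :: "real measure \<Rightarrow> real measure \<Rightarrow> real" where
  "kantorovich \<mu> \<nu> =
     (SUP f\<in>{f. 1-lipschitz_on UNIV f}. \<bar>(\<integral>x. f x \<partial>\<mu>) - (\<integral>x. f x \<partial>\<nu>)\<bar>)"

definition convex_order :: "real measure \<Rightarrow> real measure \<Rightarrow> bool" where
  "convex_order \<mu> \<nu> \<longleftrightarrow>
     (\<forall>\<phi>. convex_on UNIV \<phi> \<and> linear_growth \<phi> \<longrightarrow> (\<integral>x. \<phi> x \<partial>\<mu>) \<le> (\<integral>x. \<phi> x \<partial>\<nu>))"

definition convex_pos_order :: "real measure \<Rightarrow> real measure \<Rightarrow> bool" where
  "convex_pos_order \<mu> \<nu> \<longleftrightarrow>
     (\<forall>\<phi>. convex_on UNIV \<phi> \<and> linear_growth \<phi> \<and> (\<forall>x. 0 \<le> \<phi> x) \<longrightarrow>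
        (\<integral>x. \<phi> x \<partial>\<mu>) \<le> (\<integral>x. \<phi> x \<partial>\<nu>))"

definition setwise_order :: "real measure \<Rightarrow> real measure \<Rightarrow> bool" where
  "setwise_order \<mu> \<nu> \<longleftrightarrow> (\<forall>B\<in>sets borel. emeasure \<mu> B \<le> emeasure \<nu> B)"

definition is_shadow :: "real measure \<Rightarrow> real measure \<Rightarrow> real measure \<Rightarrow> bool" where
  "is_shadow \<nu> \<mu> \<eta> \<longleftrightarrow>
     \<eta> \<in> first_moment_measures \<and> convex_order \<mu> \<eta> \<and> setwise_order \<eta> \<nu> \<and>
     (\<forall>\<eta>'\<in>first_moment_measures.
        convex_order \<mu> \<eta>' \<and> setwise_order \<eta>' \<nu> \<longrightarrow> convex_order \<eta> \<eta>')"

text \<open>The shadow of \<open>\<mu>\<close> in \<open>\<nu>\<close>; it exists and is unique if \<open>convex_pos_order \<mu> \<nu>\<close>.\<close>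

definition shadow :: "real measure \<Rightarrow> real measure \<Rightarrow> real measure" where
  "shadow \<nu> \<mu> = (THE \<eta>. is_shadow \<nu> \<mu> \<eta>)"

lemma integrable_linear_growth:
  assumes "\<mu> \<in> first_moment_measures" "linear_growth \<phi>" "\<phi> \<in> borel_measurable borel"
  shows "integrable \<mu> \<phi>"
proof -
  from assms(1) interpret finite_measure \<mu> by (simp add: first_moment_measures_def)
  have sets: "sets \<mu> = sets borel" and m: "integrable \<mu> (\<lambda>x. x)"
    using assms(1) by (auto simp: first_moment_measures_def)
  obtain a b where ab: "\<bar>\<phi> x\<bar> \<le> a + b * \<bar>x\<bar>" for x
    using assms(2) by (auto simp: linear_growth_def)
  have "integrable \<mu> (\<lambda>x. a + b * \<bar>x\<bar>)"
    using m by (intro Bochner_Integration.integrable_add integrable_mult_right integrable_abs) auto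
  moreover have "\<phi> \<in> borel_measurable \<mu>"
    using assms(3) sets measurable_cong_sets by blast
  moreover have "norm (\<phi> x) \<le> norm (a + b * \<bar>x\<bar>)" for x
    using ab[of x] by simp
  ultimately show ?thesis
    by (intro Bochner_Integration.integrable_bound[of \<mu> "\<lambda>x. a + b * \<bar>x\<bar>" \<phi>]) auto
qed

lemma integrable_convex_linear_growth:
  assumes "\<mu> \<in> first_moment_measures" "linear_growth \<phi>" "convex_on UNIV \<phi>"
  shows "integrable \<mu> \<phi>"
  using assms convex_on_continuous[of UNIV \<phi>]
  by (intro integrable_linear_growth borel_measurable_continuous_onI) auto

lemma lipschitz_abs_diff_le:
  fixes f :: "real \<Rightarrow> real"
  assumes "1-lipschitz_on UNIV f"
  shows "\<bar>f x - f 0\<bar> \<le> \<bar>x\<bar>"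
  using lipschitz_onD[OF assms, of x 0] by (simp add: dist_real_def)

lemma integrable_lipschitz:
  fixes f :: "real \<Rightarrow> real"
  assumes "\<mu> \<in> first_moment_measures" "1-lipschitz_on UNIV f"
  shows "integrable \<mu> f"
proof (rule integrable_linear_growth[OF assms(1)])
  have "\<bar>f x\<bar> \<le> \<bar>f 0\<bar> + 1 * \<bar>x\<bar>" for x
    using lipschitz_abs_diff_le[OF assms(2), of x] by linarith
  then show "linear_growth f"
    unfolding linear_growth_def by blast
  show "f \<in> borel_measurable borel"
    using assms(2) lipschitz_on_continuous_on by (intro borel_measurable_continuous_onI) auto
qed

lemma bdd_above_kantorovich:
  assumes "\<mu> \<in> first_moment_measures" "\<nu> \<in> first_moment_measures"
    and mass: "measure \<mu> UNIV = measure \<nu> UNIV"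
  shows "bdd_above ((\<lambda>f :: real \<Rightarrow> real. \<bar>(\<integral>x. f x \<partial>\<mu>) - (\<integral>x. f x \<partial>\<nu>)\<bar>) ` {f. 1-lipschitz_on UNIV f})"
proof (rule bdd_aboveI2)
  fix f :: "real \<Rightarrow> real"
  assume "f \<in> {f. 1-lipschitz_on UNIV f}"
  then have f: "1-lipschitz_on UNIV f" by simp
  have *: "\<bar>(\<integral>x. f x \<partial>\<rho>) - f 0 * measure \<rho> UNIV\<bar> \<le> (\<integral>x. \<bar>x\<bar> \<partial>\<rho>)"
    if \<rho>: "\<rho> \<in> first_moment_measures" for \<rho>
  proof -
    from \<rho> interpret finite_measure \<rho> by (simp add: first_moment_measures_def)
    have sets: "sets \<rho> = sets borel" and m: "integrable \<rho> (\<lambda>x. x)"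
      using \<rho> by (auto simp: first_moment_measures_def)
    have sp: "space \<rho> = UNIV" using sets_eq_imp_space_eq[OF sets] by simp
    have i: "integrable \<rho> f" by (rule integrable_lipschitz[OF \<rho> f])
    have "(\<integral>x. f x \<partial>\<rho>) - f 0 * measure \<rho> UNIV = (\<integral>x. f x - f 0 \<partial>\<rho>)"
      using i by (simp add: sp)
    also have "\<bar>\<dots>\<bar> \<le> (\<integral>x. \<bar>f x - f 0\<bar> \<partial>\<rho>)"
      by (rule integral_abs_bound)
    also have "\<dots> \<le> (\<integral>x. \<bar>x\<bar> \<partial>\<rho>)"
      using i m lipschitz_abs_diff_le[OF f] by (intro integral_mono) auto
    finally show ?thesis .
  qed
  show "\<bar>(\<integral>x. f x \<partial>\<mu>) - (\<integral>x. f x \<partial>\<nu>)\<bar> \<le> (\<integral>x. \<bar>x\<bar> \<partial>\<mu>) + (\<integral>x. \<bar>x\<bar> \<partial>\<nu>)"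
    using *[OF assms(1)] *[OF assms(2)] mass by simp
qed

end

theory Submission
  imports Defs "HOL-Probability.Distribution_Functions"
begin

text \<open>
  The potential function \<open>put \<mu> k = \<integral> (k - x)\<^sup>+ d\<mu>\<close> turns the statement into one about convex
  functions on the line. It determines \<open>\<mu>\<close> (\<open>put_inject\<close>), and three translations hold. For
  measures of equal mass and mean, the convex order is the pointwise order of potential functions
  (\<open>convex_order_iff_put_le\<close>). For measures of equal mass, the Kantorovich distance is the total
  variation of the difference of the potential functions (\<open>variation_le_kantorovich\<close> and
  \<open>kantorovich_le_variation\<close>). Finally, with \<open>c(D)\<close> denoting the largest convex function below \<open>D\<close>,
  the shadow exists, is unique, and has the potential function
  \<open>put \<nu> - c(put \<nu> - put \<mu>)\<close> (\<open>shadow_put\<close>).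

  The analytic core is that \<open>c\<close> is a contraction for the total variation: the total variation of
  \<open>c(f) - c(g)\<close> is at most that of \<open>f - g\<close> (\<open>variation_le_convex_minorant\<close>). By a Jordan decomposition
  this reduces to the fact that \<open>c(f) - c(g)\<close> is nondecreasing whenever \<open>f - g\<close> is
  (\<open>convex_minorant_diff_mono\<close>).

  Hence, with \<open>D = put \<nu> - put \<mu>\<close> and \<open>D' = put \<nu>' - put \<mu>'\<close>, the difference of the potential
  functions of the two shadows is \<open>(put \<nu> - put \<nu>') - (c(D) - c(D'))\<close>. The first part has total
  variation \<open>W(\<nu>, \<nu>')\<close>. The second has at most that of \<open>D - D' = (put \<nu> - put \<nu>') - (put \<mu> - put \<mu>')\<close>,
  which is at most \<open>W(\<nu>, \<nu>') + W(\<mu>, \<mu>')\<close>.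
\<close>

section \<open>Potential functions\<close>

lemma first_moment_measuresD:
  assumes "\<mu> \<in> first_moment_measures"
  shows "finite_borel_measure \<mu>" "finite_measure \<mu>" "sets \<mu> = sets borel" "space \<mu> = UNIV"
    "integrable \<mu> (\<lambda>x. x)"
  using assms sets_eq_imp_space_eq[of \<mu> borel]
  by (auto simp: first_moment_measures_def finite_borel_measure_def finite_borel_measure_axioms_def)

lemma integrable_hinge:
  assumes "\<mu> \<in> first_moment_measures"
  shows "integrable \<mu> (\<lambda>x. max 0 (k - x))" "integrable \<mu> (\<lambda>x. max 0 (x - k))"
proof -
  interpret finite_measure \<mu> using assms by (rule first_moment_measuresD)
  have "integrable \<mu> (\<lambda>x. k - x)" "integrable \<mu> (\<lambda>x. x - k)"
    using first_moment_measuresD(5)[OF assms] by auto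
  then show "integrable \<mu> (\<lambda>x. max 0 (k - x))" "integrable \<mu> (\<lambda>x. max 0 (x - k))"
    by (auto intro: integrable_max)
qed

text \<open>
  The potential function of \<open>\<mu>\<close>: the price of a put option as a function of the strike \<open>k\<close>. Its
  second distributional derivative is \<open>\<mu>\<close>.
\<close>

definition put :: "real measure \<Rightarrow> real \<Rightarrow> real" where
  "put \<mu> k = (\<integral>x. max 0 (k - x) \<partial>\<mu>)"

lemma put_call_parity:
  assumes "\<mu> \<in> first_moment_measures"
  shows "(\<integral>x. max 0 (x - k) \<partial>\<mu>) = put \<mu> k - (k * measure \<mu> UNIV - (\<integral>x. x \<partial>\<mu>))"
proof -
  interpret finite_measure \<mu> using assms by (rule first_moment_measuresD)
  have "(\<integral>x. max 0 (x - k) \<partial>\<mu>) = (\<integral>x. max 0 (k - x) - (k - x) \<partial>\<mu>)"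
    by (intro Bochner_Integration.integral_cong) auto
  also have "\<dots> = put \<mu> k - (\<integral>x. k - x \<partial>\<mu>)"
    unfolding put_def using integrable_hinge[OF assms] first_moment_measuresD(5)[OF assms]
    by (intro Bochner_Integration.integral_diff) auto
  also have "(\<integral>x. k - x \<partial>\<mu>) = k * measure \<mu> UNIV - (\<integral>x. x \<partial>\<mu>)"
    using first_moment_measuresD(4,5)[OF assms] by simp
  finally show ?thesis .
qed

lemma tendsto_put_at_bot:
  assumes "\<mu> \<in> first_moment_measures"
  shows "(put \<mu> \<longlongrightarrow> 0) at_bot"
proof -
  interpret finite_measure \<mu> using assms by (rule first_moment_measuresD)
  have [measurable_cong]: "sets \<mu> = sets borel" by (rule first_moment_measuresD[OF assms])
  have "((\<lambda>k. \<integral>x. max 0 (- k - x) \<partial>\<mu>) \<longlongrightarrow> (\<integral>x. 0 \<partial>\<mu>)) at_top"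
  proof (rule integral_dominated_convergence_at_top[where w = "\<lambda>x. \<bar>x\<bar>"])
    show "integrable \<mu> (\<lambda>x. \<bar>x\<bar>)" using first_moment_measuresD(5)[OF assms] by simp
    show "AE x in \<mu>. ((\<lambda>k. max 0 (- k - x)) \<longlongrightarrow> 0) at_top"
    proof (rule AE_I2)
      fix x :: real show "((\<lambda>k. max 0 (- k - x)) \<longlongrightarrow> 0) at_top"
        by (rule tendsto_eventually) (use eventually_ge_at_top[of "-x"] in eventually_elim, simp)
    qed
    show "\<forall>\<^sub>F k in at_top. AE x in \<mu>. norm (max 0 (- k - x)) \<le> \<bar>x\<bar>"
      using eventually_ge_at_top[of 0] by eventually_elim auto
  qed measurable
  then have "((\<lambda>k. put \<mu> (- k)) \<longlongrightarrow> 0) at_top" by (simp add: put_def)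
  then show ?thesis by (simp add: filterlim_at_bot_mirror)
qed

text \<open>
  By put-call parity the difference is the price of a call, which vanishes for large strikes. So
  the asymptote of the potential function records mass and mean.
\<close>

lemma tendsto_put_at_top:
  assumes "\<mu> \<in> first_moment_measures"
  shows "((\<lambda>k. put \<mu> k - (k * measure \<mu> UNIV - (\<integral>x. x \<partial>\<mu>))) \<longlongrightarrow> 0) at_top"
proof -
  interpret finite_measure \<mu> using assms by (rule first_moment_measuresD)
  have [measurable_cong]: "sets \<mu> = sets borel" by (rule first_moment_measuresD[OF assms])
  have "((\<lambda>k. \<integral>x. max 0 (x - k) \<partial>\<mu>) \<longlongrightarrow> (\<integral>x. 0 \<partial>\<mu>)) at_top"
  proof (rule integral_dominated_convergence_at_top[where w = "\<lambda>x. \<bar>x\<bar>"])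
    show "integrable \<mu> (\<lambda>x. \<bar>x\<bar>)" using first_moment_measuresD(5)[OF assms] by simp
    show "AE x in \<mu>. ((\<lambda>k. max 0 (x - k)) \<longlongrightarrow> 0) at_top"
    proof (rule AE_I2)
      fix x :: real show "((\<lambda>k. max 0 (x - k)) \<longlongrightarrow> 0) at_top"
        by (rule tendsto_eventually) (use eventually_ge_at_top[of x] in eventually_elim, simp)
    qed
    show "\<forall>\<^sub>F k in at_top. AE x in \<mu>. norm (max 0 (x - k)) \<le> \<bar>x\<bar>"
      using eventually_ge_at_top[of 0] by eventually_elim auto
  qed measurable
  then show ?thesis by (simp add: put_call_parity[OF assms])
qed

lemma convex_on_hinge: "convex_on UNIV (\<lambda>x::real. max 0 (k - x))" "convex_on UNIV (\<lambda>x::real. max 0 (x - k))"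
proof -
  have *: "max 0 ((1 - t) * a + t * b) \<le> (1 - t) * max 0 a + t * max 0 b"
    if "0 < t" "t < 1" for t a b :: real
    using that by (intro max.boundedI add_nonneg_nonneg add_mono mult_left_mono mult_nonneg_nonneg) auto
  have e: "k - ((1 - t) *\<^sub>R a + t *\<^sub>R b) = (1 - t) * (k - a) + t * (k - b)"
     "((1 - t) *\<^sub>R a + t *\<^sub>R b) - k = (1 - t) * (a - k) + t * (b - k)" for t a b :: real
    by (simp_all add: algebra_simps)
  show "convex_on UNIV (\<lambda>x::real. max 0 (k - x))" "convex_on UNIV (\<lambda>x::real. max 0 (x - k))"
    by (rule convex_onI, unfold e, erule (1) *, rule convex_UNIV)+
qed

lemma convex_on_put:
  assumes "\<mu> \<in> first_moment_measures"
  shows "convex_on UNIV (put \<mu>)"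
proof (rule convex_onI)
  fix t a b :: real assume t: "0 < t" "t < 1"
  have "put \<mu> ((1 - t) *\<^sub>R a + t *\<^sub>R b) \<le> (\<integral>x. (1 - t) * max 0 (a - x) + t * max 0 (b - x) \<partial>\<mu>)"
    unfolding put_def
  proof (rule integral_mono)
    show "max 0 ((1 - t) *\<^sub>R a + t *\<^sub>R b - x) \<le> (1 - t) * max 0 (a - x) + t * max 0 (b - x)" for x
      using convex_onD[OF convex_on_hinge(2)[of x], of t a b] t by simp
  qed (use integrable_hinge[OF assms] in auto)
  also have "\<dots> = (1 - t) * put \<mu> a + t * put \<mu> b"
    unfolding put_def using integrable_hinge[OF assms] by simp
  finally show "put \<mu> ((1 - t) *\<^sub>R a + t *\<^sub>R b) \<le> (1 - t) * put \<mu> a + t * put \<mu> b" .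
qed simp

text \<open>
  The integrand vanishes on \<open>x \<ge> k\<close>, is at most \<open>k - j\<close>, and equals \<open>k - j\<close> on \<open>x \<le> j\<close>. Since it is
  bounded, the estimate can serve in \<open>measure_with_put\<close> before the first moment is known to be finite.
\<close>

lemma cdf_put_increment:
  assumes \<mu>: "finite_borel_measure \<mu>" and jk: "j \<le> k"
  shows "cdf \<mu> j * (k - j) \<le> (\<integral>x. max 0 (k - x) - max 0 (j - x) \<partial>\<mu>)"
    and "(\<integral>x. max 0 (k - x) - max 0 (j - x) \<partial>\<mu>) \<le> cdf \<mu> k * (k - j)"
    and "integrable \<mu> (\<lambda>x. max 0 (k - x) - max 0 (j - x))"
proof -
  interpret finite_borel_measure \<mu> by (rule \<mu>)
  have [measurable_cong]: "sets \<mu> = sets borel" by (rule M_is_borel)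
  show i: "integrable \<mu> (\<lambda>x. max 0 (k - x) - max 0 (j - x))"
    by (rule integrable_const_bound[where B = "k - j"]) (use jk in auto)
  have ind: "integrable \<mu> (\<lambda>x. indicator {..c} x * (k - j))" for c
    by (rule integrable_const_bound[where B = "k - j"]) (use jk in \<open>auto simp: indicator_def\<close>)
  have int: "(\<integral>x. indicator {..c} x * (k - j) \<partial>\<mu>) = cdf \<mu> c * (k - j)" for c
    by (simp add: cdf_def borel_UNIV)
  show "cdf \<mu> j * (k - j) \<le> (\<integral>x. max 0 (k - x) - max 0 (j - x) \<partial>\<mu>)"
    unfolding int[symmetric]
    by (rule integral_mono[OF ind i]) (use jk in \<open>simp add: indicator_def max_def\<close>)
  show "(\<integral>x. max 0 (k - x) - max 0 (j - x) \<partial>\<mu>) \<le> cdf \<mu> k * (k - j)"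
    unfolding int[symmetric]
    by (rule integral_mono[OF i ind]) (use jk in \<open>simp add: indicator_def max_def\<close>)
qed

lemma put_diff:
  assumes "\<mu> \<in> first_moment_measures"
  shows "put \<mu> k - put \<mu> j = (\<integral>x. max 0 (k - x) - max 0 (j - x) \<partial>\<mu>)"
  unfolding put_def using integrable_hinge[OF assms] by simp

lemma tendsto_put_slope:
  assumes "\<mu> \<in> first_moment_measures"
  shows "((\<lambda>y. (put \<mu> y - put \<mu> x) / (y - x)) \<longlongrightarrow> cdf \<mu> x) (at_right x)"
proof (rule tendsto_sandwich)
  interpret finite_borel_measure \<mu> using assms by (rule first_moment_measuresD)
  show "((\<lambda>_. cdf \<mu> x) \<longlongrightarrow> cdf \<mu> x) (at_right x)" by simp
  show "(cdf \<mu> \<longlongrightarrow> cdf \<mu> x) (at_right x)"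
    using cdf_is_right_cont by (simp add: continuous_within)
  have *: "y > x \<Longrightarrow> cdf \<mu> x \<le> (put \<mu> y - put \<mu> x) / (y - x) \<and>
      (put \<mu> y - put \<mu> x) / (y - x) \<le> cdf \<mu> y" for y
    using cdf_put_increment(1,2)[OF finite_borel_measure_axioms, of x y]
    by (simp add: put_diff[OF assms] pos_le_divide_eq pos_divide_le_eq)
  show "\<forall>\<^sub>F y in at_right x. cdf \<mu> x \<le> (put \<mu> y - put \<mu> x) / (y - x)"
    "\<forall>\<^sub>F y in at_right x. (put \<mu> y - put \<mu> x) / (y - x) \<le> cdf \<mu> y"
    using * by (auto simp: eventually_at_filter)
qed

text \<open>
  A measure is the second derivative of its potential function: the right derivative is the
  distribution function, which determines the measure.
\<close>

lemma put_inject: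
  assumes \<mu>: "\<mu> \<in> first_moment_measures" and \<nu>: "\<nu> \<in> first_moment_measures"
    and eq: "put \<mu> = put \<nu>"
  shows "\<mu> = \<nu>"
proof (rule cdf_unique')
  show "cdf \<mu> = cdf \<nu>"
  proof
    fix x
    show "cdf \<mu> x = cdf \<nu> x"
      using tendsto_put_slope[OF \<mu>, of x] tendsto_put_slope[OF \<nu>, of x] unfolding eq
      by (rule tendsto_unique[OF trivial_limit_at_right_real])
  qed
qed (rule first_moment_measuresD \<mu> \<nu>)+

section \<open>Convex functions that are potential functions\<close>

text \<open>
  Over a partition of an interval into \<open>N\<close> equal pieces the bounds telescope to
  \<open>(F b - F a) * (b - a) / N\<close>, which is arbitrarily small.
\<close>

lemma constant_if_increment_le:
  fixes h F :: "real \<Rightarrow> real"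
  assumes inc: "\<And>j k. j \<le> k \<Longrightarrow> \<bar>h k - h j\<bar> \<le> (F k - F j) * (k - j)"
  shows "h a = h b"
proof -
  have *: "h b = h a" if "a \<le> b" for a b
  proof -
    have bound: "\<bar>h b - h a\<bar> \<le> (F b - F a) * (b - a) * inverse (real (Suc n))" for n
    proof -
      define \<delta> where "\<delta> = (b - a) * inverse (real (Suc n))"
      define x where "x i = a + real i * \<delta>" for i
      have x0: "x 0 = a" and xN: "x (Suc n) = b"
        by (simp_all add: x_def \<delta>_def divide_inverse[symmetric] del: of_nat_Suc)
      have \<delta>: "0 \<le> \<delta>" using that by (simp add: \<delta>_def)
      have step: "x (Suc i) - x i = \<delta>" for i by (simp add: x_def algebra_simps)
      have "h b - h a = (\<Sum>i<Suc n. h (x (Suc i)) - h (x i))"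
        by (subst sum_lessThan_telescope) (simp only: x0 xN)
      also have "\<bar>\<dots>\<bar> \<le> (\<Sum>i<Suc n. \<bar>h (x (Suc i)) - h (x i)\<bar>)"
        by (rule sum_abs)
      also have "\<dots> \<le> (\<Sum>i<Suc n. (F (x (Suc i)) - F (x i)) * \<delta>)"
      proof (rule sum_mono)
        fix i
        show "\<bar>h (x (Suc i)) - h (x i)\<bar> \<le> (F (x (Suc i)) - F (x i)) * \<delta>"
          using inc[of "x i" "x (Suc i)"] step[of i] \<delta> by simp
      qed
      also have "\<dots> = (F b - F a) * \<delta>"
        unfolding sum_distrib_right[symmetric]
        by (subst sum_lessThan_telescope) (simp only: x0 xN)
      finally show ?thesis by (simp add: \<delta>_def)
    qed
    have "(\<lambda>n. (F b - F a) * (b - a) * inverse (real (Suc n))) \<longlonglongrightarrow> (F b - F a) * (b - a) * 0"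
      by (intro tendsto_intros LIMSEQ_inverse_real_of_nat)
    from LIMSEQ_le_const[OF this, of "\<bar>h b - h a\<bar>"] bound have "\<bar>h b - h a\<bar> \<le> 0" by auto
    then show ?thesis by simp
  qed
  show ?thesis using *[of a b] *[of b a] by linarith
qed

text \<open>
  For convex \<open>U\<close> the difference quotients decrease to the right derivative, so the infimum is
  the limit.
\<close>

definition right_slope :: "(real \<Rightarrow> real) \<Rightarrow> real \<Rightarrow> real" where
  "right_slope U x = (INF y\<in>{x<..}. (U y - U x) / (y - x))"

lemma right_slope_bounds:
  assumes U: "convex_on UNIV U"
  shows "x < y \<Longrightarrow> right_slope U x \<le> (U y - U x) / (y - x)"
    and "w < x \<Longrightarrow> (U x - U w) / (x - w) \<le> right_slope U x"
proof -
  have three: "(U x - U w) / (x - w) \<le> (U y - U x) / (y - x)" if "w < x" "x < y" for w x y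
  proof -
    have e: "(p - q) / (r - s) = (q - p) / (s - r)" for p q r s :: real
      by (metis minus_diff_eq minus_divide_divide)
    have "(U w - U x) / (w - x) \<le> (U x - U y) / (x - y)"
      using convex_on_slope_le[OF U, of w y x] that by (meson UNIV_I order_trans)
    then show ?thesis by (simp add: e[of "U w"] e[of "U x" "U y"])
  qed
  show "right_slope U x \<le> (U y - U x) / (y - x)" if "x < y"
    unfolding right_slope_def
    by (rule cINF_lower) (use three[of "x - 1" x] that in \<open>auto intro!: bdd_belowI\<close>)
  show "(U x - U w) / (x - w) \<le> right_slope U x" if "w < x"
    unfolding right_slope_def by (rule cINF_greatest) (use three that in auto)
qed

lemma right_slope_mono:
  assumes U: "convex_on UNIV U" and "x \<le> y"
  shows "right_slope U x \<le> right_slope U y"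
  using right_slope_bounds[OF U, of x y] right_slope_bounds(2)[OF U, of x y] assms(2)
  by (cases "x = y") auto

text \<open>
  An infimum of functions that are continuous at \<open>x\<close> is upper semicontinuous there, and a
  nondecreasing upper semicontinuous function is continuous from the right.
\<close>

lemma continuous_right_slope:
  assumes U: "convex_on UNIV U"
  shows "continuous (at_right x) (right_slope U)"
  unfolding continuous_within
proof (rule order_tendstoI)
  fix c assume "c < right_slope U x"
  then show "\<forall>\<^sub>F y in at_right x. c < right_slope U y"
    unfolding eventually_at_filter using right_slope_mono[OF U, of x]
    by (intro always_eventually) (metis greaterThan_iff less_eq_real_def order_less_le_trans)
next
  fix c assume "right_slope U x < c"
  then obtain z where z: "x < z" "(U z - U x) / (z - x) < c"
    unfolding right_slope_def
    by (subst (asm) cInf_less_iff)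
       (use right_slope_bounds(1)[OF U, of x] in \<open>auto intro!: bdd_belowI[of _ "right_slope U x"]\<close>)
  have "isCont U x"
    using convex_on_continuous[OF open_UNIV U] by (simp add: continuous_on_eq_continuous_at)
  then have "isCont (\<lambda>w. (U z - U w) / (z - w)) x"
    using z by (intro continuous_intros) auto
  then have "((\<lambda>w. (U z - U w) / (z - w)) \<longlongrightarrow> (U z - U x) / (z - x)) (at_right x)"
    by (simp add: isCont_def filterlim_at_split)
  from order_tendstoD(2)[OF this z(2)]
  have "\<forall>\<^sub>F w in at_right x. (U z - U w) / (z - w) < c" .
  moreover have "\<forall>\<^sub>F w in at_right x. w < z"
    using z(1) by (rule eventually_at_right_real[THEN eventually_mono]) simp
  ultimately show "\<forall>\<^sub>F w in at_right x. right_slope U w < c"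
    by eventually_elim (use right_slope_bounds(1)[OF U] in fastforce)
qed

text \<open>
  Every convex function with the asymptotes of a potential function is one. The right derivative
  \<open>F\<close> of \<open>U\<close> increases from \<open>0\<close> to \<open>m\<close>, hence is the distribution function of a measure \<open>\<eta>\<close> of
  mass \<open>m\<close>. The increments of \<open>U\<close> and those of the potential function of \<open>\<eta>\<close> over \<open>[j, k]\<close> both lie
  between \<open>F j * (k - j)\<close> and \<open>F k * (k - j)\<close>, so they agree by \<open>constant_if_increment_le\<close>. Letting
  one strike tend to \<open>-\<infinity>\<close> or to \<open>\<infinity>\<close> in these increments then yields, by monotone convergence, the
  integrals of \<open>max 0 (k - x)\<close> and of \<open>max 0 x\<close>, hence the first moment.
\<close>

lemma measure_with_put:
  assumes U: "convex_on UNIV U" and bot: "(U \<longlongrightarrow> 0) at_bot"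
    and top: "((\<lambda>k. U k - (k * m - M)) \<longlongrightarrow> 0) at_top"
  obtains \<eta> where "\<eta> \<in> first_moment_measures" "put \<eta> = U" "measure \<eta> UNIV = m" "(\<integral>x. x \<partial>\<eta>) = M"
proof -
  define F where "F = right_slope U"
  have mono: "x \<le> y \<Longrightarrow> F x \<le> F y" for x y
    unfolding F_def by (rule right_slope_mono[OF U])
  have right: "continuous (at_right a) F" for a
    unfolding F_def by (rule continuous_right_slope[OF U])
  have lower: "U x - U (x - 1) \<le> F x" and upper: "F x \<le> U (x + 1) - U x" for x
    using right_slope_bounds(2)[OF U, of "x - 1" x] right_slope_bounds(1)[OF U, of x "x + 1"]
    by (simp_all add: F_def)
  have shift: "filterlim (\<lambda>x::real. x - 1) at_bot at_bot" "filterlim (\<lambda>x::real. x + 1) at_bot at_bot"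
     "filterlim (\<lambda>x::real. x - 1) at_top at_top" "filterlim (\<lambda>x::real. x + 1) at_top at_top"
    by real_asymp+
  have F_bot: "(F \<longlongrightarrow> 0) at_bot"
  proof (rule tendsto_sandwich)
    show "((\<lambda>x. U x - U (x - 1)) \<longlongrightarrow> 0) at_bot" "((\<lambda>x. U (x + 1) - U x) \<longlongrightarrow> 0) at_bot"
      using tendsto_diff[OF bot filterlim_compose[OF bot shift(1)]]
        tendsto_diff[OF filterlim_compose[OF bot shift(2)] bot] by simp_all
  qed (use lower upper in auto)
  have F_top: "(F \<longlongrightarrow> m) at_top"
  proof (rule tendsto_sandwich)
    show "((\<lambda>x. U x - U (x - 1)) \<longlongrightarrow> m) at_top" "((\<lambda>x. U (x + 1) - U x) \<longlongrightarrow> m) at_top"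
      using tendsto_add[OF tendsto_diff[OF top filterlim_compose[OF top shift(3)]] tendsto_const[of m]]
        tendsto_add[OF tendsto_diff[OF filterlim_compose[OF top shift(4)] top] tendsto_const[of m]]
      by (simp_all add: algebra_simps)
  qed (use lower upper in auto)
  have "0 \<le> F x" for x
    by (rule tendsto_upperbound[OF F_bot])
       (use mono in \<open>auto intro: eventually_mono[OF eventually_le_at_bot[of x]]\<close>)
  then have m: "0 \<le> m"
    by (intro tendsto_lowerbound[OF F_top]) auto
  define \<eta> where "\<eta> = interval_measure F"
  have fin: "finite_borel_measure \<eta>" and mass: "emeasure \<eta> UNIV = m"
    unfolding \<eta>_def using finite_borel_measure_interval_measure[OF mono right F_bot F_top m]
      interval_measure_UNIV[OF mono right F_bot F_top m] by auto
  interpret finite_borel_measure \<eta> by (rule fin)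
  have [measurable_cong]: "sets \<eta> = sets borel" by (rule M_is_borel)
  have mass': "measure \<eta> UNIV = m" using mass m by (simp add: measure_def)
  have cdf: "cdf \<eta> = F"
    unfolding \<eta>_def by (rule cdf_interval_measure[OF mono right F_bot])
  have int: "integrable \<eta> (\<lambda>x. max 0 (k - x) - max 0 (j - x))" for j k
  proof (cases "j \<le> k")
    case False
    then show ?thesis
      using integrable_minus[OF cdf_put_increment(3)[OF fin, of k j]] by simp
  qed (rule cdf_put_increment(3)[OF fin])
  \<comment> \<open>the potential function of \<open>\<eta>\<close>, normalised at strike \<open>0\<close> to have a bounded integrand\<close>
  define V where "V k = (\<integral>x. max 0 (k - x) - max 0 (0 - x) \<partial>\<eta>)" for k
  have V: "V k - V j = (\<integral>x. max 0 (k - x) - max 0 (j - x) \<partial>\<eta>)" for j k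
    unfolding V_def by (subst Bochner_Integration.integral_diff[symmetric, OF int int]) simp
  have UV: "U k - V k = U j - V j" for j k
  proof (rule constant_if_increment_le[where F = F and h = "\<lambda>k. U k - V k"])
    fix j k :: real assume jk: "j \<le> k"
    show "\<bar>(U k - V k) - (U j - V j)\<bar> \<le> (F k - F j) * (k - j)"
    proof (cases "j = k")
      case False
      with jk have "j < k" by simp
      then have "F j * (k - j) \<le> U k - U j" "U k - U j \<le> F k * (k - j)"
        using right_slope_bounds(1)[OF U, of j k] right_slope_bounds(2)[OF U, of j k]
        by (simp_all add: F_def pos_le_divide_eq pos_divide_le_eq)
      moreover have "F j * (k - j) \<le> V k - V j" "V k - V j \<le> F k * (k - j)"
        using cdf_put_increment(1,2)[OF fin jk] by (simp_all add: V cdf)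
      ultimately show ?thesis by (simp add: algebra_simps abs_le_iff)
    qed simp
  qed
  have incr: "(\<integral>x. max 0 (k - x) - max 0 (j - x) \<partial>\<eta>) = U k - U j" for j k
    using UV[of k j] V[of k j] by simp
  have neg: "filterlim (\<lambda>n. - real n) at_bot sequentially" by real_asymp
  have put: "integrable \<eta> (\<lambda>x. max 0 (k - x)) \<and> (\<integral>x. max 0 (k - x) \<partial>\<eta>) = U k" for k
  proof -
    have lim: "(\<lambda>n. \<integral>x. max 0 (k - x) - max 0 (- real n - x) \<partial>\<eta>) \<longlonglongrightarrow> U k"
      unfolding incr using tendsto_diff[OF tendsto_const[of "U k"] filterlim_compose[OF bot neg]] by simp
    have "has_bochner_integral \<eta> (\<lambda>x. max 0 (k - x)) (U k)"
    proof (rule has_bochner_integral_monotone_convergence[OF int _ _ lim])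
      show "AE x in \<eta>. mono (\<lambda>n. max 0 (k - x) - max 0 (- real n - x))"
        by (rule AE_I2) (auto simp: mono_def)
      show "AE x in \<eta>. (\<lambda>n. max 0 (k - x) - max 0 (- real n - x)) \<longlonglongrightarrow> max 0 (k - x)"
      proof (rule AE_I2)
        fix x
        have "\<forall>\<^sub>F n in sequentially. max 0 (k - x) - max 0 (- real n - x) = max 0 (k - x)"
          using eventually_ge_at_top[of "nat \<lceil>- x\<rceil>"] by eventually_elim linarith
        then show "(\<lambda>n. max 0 (k - x) - max 0 (- real n - x)) \<longlonglongrightarrow> max 0 (k - x)"
          by (rule tendsto_eventually)
      qed
    qed measurable
    then show ?thesis by (simp add: has_bochner_integral_iff)
  qed
  have call: "has_bochner_integral \<eta> (\<lambda>x. max 0 x) (M + U 0)"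
  proof -
    have e: "max 0 x - max 0 (x - real n) = real n - (max 0 (real n - x) - max 0 (0 - x))" for x n
      by auto
    have i: "integrable \<eta> (\<lambda>x. max 0 x - max 0 (x - real n))" for n
      unfolding e by (intro Bochner_Integration.integrable_diff int integrable_const)
    have "(\<integral>x. max 0 x - max 0 (x - real n) \<partial>\<eta>) = real n * m - (U (real n) - U 0)" for n
      unfolding e by (subst Bochner_Integration.integral_diff[OF integrable_const int])
        (unfold incr, simp add: borel_UNIV mass')
    moreover have "(\<lambda>n. real n * m - (U (real n) - U 0)) \<longlonglongrightarrow> M + U 0"
      using tendsto_diff[OF tendsto_const[of "M + U 0"] filterlim_compose[OF top filterlim_real_sequentially]]
      by (simp add: algebra_simps)
    ultimately have lim: "(\<lambda>n. \<integral>x. max 0 x - max 0 (x - real n) \<partial>\<eta>) \<longlonglongrightarrow> M + U 0" by simp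
    show ?thesis
    proof (rule has_bochner_integral_monotone_convergence[OF i _ _ lim])
      show "AE x in \<eta>. mono (\<lambda>n. max 0 x - max 0 (x - real n))"
        by (rule AE_I2) (auto simp: mono_def)
      show "AE x in \<eta>. (\<lambda>n. max 0 x - max 0 (x - real n)) \<longlonglongrightarrow> max 0 x"
      proof (rule AE_I2)
        fix x
        have "\<forall>\<^sub>F n in sequentially. max 0 x - max 0 (x - real n) = max 0 x"
          using eventually_ge_at_top[of "nat \<lceil>x\<rceil>"] by eventually_elim linarith
        then show "(\<lambda>n. max 0 x - max 0 (x - real n)) \<longlonglongrightarrow> max 0 x"
          by (rule tendsto_eventually)
      qed
    qed measurable
  qed
  have "has_bochner_integral \<eta> (\<lambda>x. max 0 x - max 0 (0 - x)) (M + U 0 - U 0)"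
    using put[of 0] by (intro has_bochner_integral_diff call) (simp add: has_bochner_integral_iff)
  moreover have "max 0 x - max 0 (0 - x) = x" for x :: real by auto
  ultimately have "has_bochner_integral \<eta> (\<lambda>x. x) M" by simp
  then have "integrable \<eta> (\<lambda>x. x)" "(\<integral>x. x \<partial>\<eta>) = M" by (simp_all add: has_bochner_integral_iff)
  moreover from this have "\<eta> \<in> first_moment_measures"
    by (simp add: first_moment_measures_def M_is_borel finite_measure_axioms)
  moreover have "put \<eta> = U" using put by (auto simp: put_def)
  ultimately show ?thesis using that mass' by blast
qed

section \<open>Convex minorants\<close>

definition affine_below :: "(real \<Rightarrow> real) \<Rightarrow> real \<Rightarrow> real \<Rightarrow> bool" where
  "affine_below f a b \<longleftrightarrow> (\<forall>t. a * t + b \<le> f t)"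

text \<open>
  The largest convex function below \<open>f\<close>, provided that \<open>f\<close> has an affine minorant at all.
\<close>

definition convex_minorant :: "(real \<Rightarrow> real) \<Rightarrow> real \<Rightarrow> real" where
  "convex_minorant f x = Sup {a * x + b |a b. affine_below f a b}"

lemma affine_le_convex_minorant:
  assumes "affine_below f a b"
  shows "a * x + b \<le> convex_minorant f x"
  unfolding convex_minorant_def
proof (rule cSup_upper)
  show "bdd_above {a * x + b |a b. affine_below f a b}"
    by (rule bdd_aboveI[of _ "f x"]) (auto simp: affine_below_def)
qed (use assms in blast)

lemma convex_minorant_least:
  assumes "affine_below f a b" and "\<And>a b. affine_below f a b \<Longrightarrow> a * x + b \<le> z"
  shows "convex_minorant f x \<le> z"
  unfolding convex_minorant_def by (rule cSup_least) (use assms in blast)+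

lemma convex_minorant_le:
  assumes "affine_below f a b"
  shows "convex_minorant f x \<le> f x"
  by (rule convex_minorant_least[OF assms]) (simp add: affine_below_def)

lemma convex_on_convex_minorant:
  assumes "affine_below f a b"
  shows "convex_on UNIV (convex_minorant f)"
proof (rule convex_onI)
  fix t x y :: real
  assume t: "0 < t" "t < 1"
  show "convex_minorant f ((1 - t) *\<^sub>R x + t *\<^sub>R y)
      \<le> (1 - t) * convex_minorant f x + t * convex_minorant f y"
  proof (rule convex_minorant_least[OF assms])
    fix a b assume ab: "affine_below f a b"
    have "a * ((1 - t) *\<^sub>R x + t *\<^sub>R y) + b = (1 - t) * (a * x + b) + t * (a * y + b)"
      by (simp add: algebra_simps)
    also have "\<dots> \<le> (1 - t) * convex_minorant f x + t * convex_minorant f y"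
      using t by (intro add_mono mult_left_mono affine_le_convex_minorant[OF ab]) auto
    finally show "a * ((1 - t) *\<^sub>R x + t *\<^sub>R y) + b \<le> \<dots>" .
  qed
qed simp

lemma convex_supporting_line:
  fixes g :: "real \<Rightarrow> real"
  assumes "convex_on UNIV g"
  obtains a where "\<And>t. g x + a * (t - x) \<le> g t"
  using convex_le_Inf_differential[OF assms, of x] by auto

lemma convex_le_convex_minorant:
  assumes "convex_on UNIV g" and "\<And>t. g t \<le> f t"
  shows "g x \<le> convex_minorant f x"
proof -
  obtain a where a: "\<And>t. g x + a * (t - x) \<le> g t"
    using convex_supporting_line[OF assms(1)] by blast
  have "affine_below f a (g x - a * x)"
    unfolding affine_below_def
  proof
    fix t show "a * t + (g x - a * x) \<le> f t"
      using a[of t] assms(2)[of t] by (simp add: algebra_simps)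
  qed
  from affine_le_convex_minorant[OF this, of x] show ?thesis by simp
qed

lemma convex_minorant_le_shift:
  assumes "affine_below f a b" and "\<And>x. f x \<le> g x + c"
  shows "convex_minorant f x \<le> convex_minorant g x + c"
proof (rule convex_minorant_least[OF assms(1)])
  fix a b assume "affine_below f a b"
  then have "affine_below g a (b - c)"
    using assms(2) unfolding affine_below_def by (smt (verit))
  from affine_le_convex_minorant[OF this, of x]
  show "a * x + b \<le> convex_minorant g x + c" by simp
qed

text \<open>
  Adding a nondecreasing function \<open>f - g\<close> to \<open>g\<close> moves the minimisers of \<open>t \<mapsto> g t - s * t\<close> to the left
  for every slope \<open>s\<close>, so it raises the derivative of the convex minorant everywhere. The proof
  avoids minimisers: given an affine minorant \<open>l\<close> of \<open>f\<close>, to be evaluated at \<open>x\<close>, and an affine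
  minorant \<open>m\<close> of \<open>g\<close>, to be evaluated at \<open>y\<close>, the two points are exchanged. If \<open>l\<close> is at least as
  steep as \<open>m\<close>, exchanging the points of evaluation does not decrease the sum. Otherwise \<open>l - m\<close> is
  decreasing while \<open>f - g\<close> is nondecreasing; a number \<open>q\<close> between the two functions, the height at
  which they cross, makes \<open>m + q\<close> a minorant of \<open>f\<close> and \<open>l - q\<close> a minorant of \<open>g\<close>.
\<close>

lemma convex_minorant_diff_mono:
  assumes fb: "affine_below f a0 b0" and gb: "affine_below g a1 b1"
    and inc: "\<And>x y. x \<le> y \<Longrightarrow> f x - g x \<le> f y - g y"
    and xy: "x \<le> y"
  shows "convex_minorant f x - convex_minorant g x \<le> convex_minorant f y - convex_minorant g y"
proof -
  let ?u = "convex_minorant f" and ?v = "convex_minorant g"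
  have key: "(s * x + b) + (r * y + c) \<le> ?u y + ?v x"
    if l: "affine_below f s b" and m: "affine_below g r c" for s b r c
  proof (cases "r \<le> s")
    case True
    have "(s * x + b) + (r * y + c) \<le> (s * y + b) + (r * x + c)"
      using mult_right_mono[OF True, of "y - x"] xy by (simp add: algebra_simps)
    also have "\<dots> \<le> ?u y + ?v x"
      by (intro add_mono affine_le_convex_minorant l m)
    finally show ?thesis .
  next
    case False
    let ?d = "\<lambda>t. (s * t + b) - (r * t + c)"
    have dec: "?d y \<le> ?d x" if "x \<le> y" for x y
      using mult_left_mono[OF that, of "r - s"] False by (simp add: algebra_simps)
    \<comment> \<open>two monotone functions of opposite direction: every minimum is below every maximum\<close>
    let ?lo = "\<lambda>t. min (f t - g t) (?d t)" and ?hi = "\<lambda>t. max (f t - g t) (?d t)"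
    have lohi: "?lo t \<le> ?hi t'" for t t'
      using inc[of t t'] dec[of t' t] by linarith
    define q where "q = (SUP t. ?lo t)"
    have lo: "?lo t \<le> q" for t
      unfolding q_def by (rule cSUP_upper) (auto intro!: bdd_aboveI[of _ "?hi 0"] lohi)
    have hi: "q \<le> ?hi t" for t
      unfolding q_def by (rule cSUP_least) (auto intro!: lohi)
    have "r * t + (c + q) \<le> f t \<and> s * t + (b - q) \<le> g t" for t
      using lo[of t] hi[of t] l[unfolded affine_below_def, rule_format, of t]
        m[unfolded affine_below_def, rule_format, of t] by linarith
    then have "\<exists>q. affine_below f r (c + q) \<and> affine_below g s (b - q)"
      unfolding affine_below_def by blast
    then obtain q where "affine_below f r (c + q)" "affine_below g s (b - q)" by blast
    from affine_le_convex_minorant[OF this(1), of y] affine_le_convex_minorant[OF this(2), of x]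
    show ?thesis by simp
  qed
  have "?u x \<le> ?u y + ?v x - ?v y"
  proof (rule convex_minorant_least[OF fb])
    fix s b assume l: "affine_below f s b"
    have "?v y \<le> ?u y + ?v x - (s * x + b)"
    proof (rule convex_minorant_least[OF gb])
      fix r c assume "affine_below g r c"
      from key[OF l this] show "r * y + c \<le> ?u y + ?v x - (s * x + b)" by simp
    qed
    then show "s * x + b \<le> ?u y + ?v x - ?v y" by simp
  qed
  then show ?thesis by simp
qed

lemma convex_nonneg_beyond:
  fixes h :: "real \<Rightarrow> real"
  assumes h: "convex_on UNIV h" and "h x < 0" "0 \<le> h z" and z: "z \<in> closed_segment p x"
  shows "0 \<le> h p"
proof (rule ccontr)
  assume neg: "\<not> 0 \<le> h p"
  obtain s where s: "0 \<le> s" "s \<le> 1" "z = (1 - s) * p + s * x"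
    using z by (auto simp: closed_segment_def)
  have "h z \<le> (1 - s) * h p + s * h x"
    using convex_onD[OF h, of s p x] s by simp
  also have "\<dots> < 0"
  proof (cases "s = 0")
    case False
    then have "s * h x < 0" using s assms(2) by (simp add: mult_pos_neg)
    moreover have "(1 - s) * h p \<le> 0" using s neg by (simp add: mult_nonneg_nonpos)
    ultimately show ?thesis by simp
  qed (use neg in simp)
  finally show False using assms(3) by simp
qed

text \<open>
  Let \<open>u\<close> be the convex minorant of \<open>g - f\<close>. On \<open>[a, b]\<close>, subtract from \<open>g\<close> the chord of \<open>g - u\<close>. The
  result is convex and agrees with \<open>u\<close> at \<open>a\<close> and \<open>b\<close>; convexity of \<open>f\<close> gives that it lies below
  \<open>g - f\<close> in between. Were it above \<open>u\<close> at an intermediate point \<open>x\<close>, its tangent there would be an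
  affine minorant of \<open>g - f\<close>: outside \<open>[a, b]\<close> the tangent is even below \<open>u\<close>, because it is above \<open>u\<close>
  at \<open>x\<close> and not above \<open>u\<close> at \<open>a\<close> and \<open>b\<close>. But an affine minorant cannot exceed \<open>u\<close> at \<open>x\<close>.
\<close>

lemma convex_on_diff_convex_minorant:
  assumes f: "convex_on UNIV f" and g: "convex_on UNIV g"
    and fb: "affine_below (\<lambda>t. g t - f t) a0 b0"
  shows "convex_on UNIV (\<lambda>x. g x - convex_minorant (\<lambda>t. g t - f t) x)"
proof (rule convex_on_linorderI)
  let ?D = "\<lambda>t. g t - f t"
  let ?u = "convex_minorant ?D"
  fix t a b :: real
  assume t: "0 < t" "t < 1" and ab: "a < b"
  define x where "x = (1 - t) *\<^sub>R a + t *\<^sub>R b"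
  have u: "convex_on UNIV ?u"
    by (rule convex_on_convex_minorant[OF fb])
  \<comment> \<open>\<open>e\<close> is the height at \<open>x\<close>, and \<open>\<kappa>\<close> the slope, of the chord of \<open>g - u\<close> over \<open>[a, b]\<close>\<close>
  define e where "e = (1 - t) * (g a - ?u a) + t * (g b - ?u b)"
  define \<kappa> where "\<kappa> = ((g b - ?u b) - (g a - ?u a)) / (b - a)"
  have \<kappa>: "\<kappa> * (b - a) = (g b - ?u b) - (g a - ?u a)"
    using ab by (simp add: \<kappa>_def)
  have x: "a - x = - t * (b - a)" "b - x = (1 - t) * (b - a)"
    by (simp_all add: x_def algebra_simps)
  have "\<kappa> * (a - x) = - t * (\<kappa> * (b - a))" "\<kappa> * (b - x) = (1 - t) * (\<kappa> * (b - a))"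
    unfolding x by simp_all
  then have ea: "e + \<kappa> * (a - x) = g a - ?u a" and eb: "e + \<kappa> * (b - x) = g b - ?u b"
    unfolding \<kappa> by (simp_all add: e_def algebra_simps)
  have axb: "a < x" "x < b"
    using x t ab mult_pos_pos[of t "b - a"] mult_pos_pos[of "1 - t" "b - a"] by linarith+
  have "g x - e \<le> ?u x"
  proof (rule ccontr)
    assume neg: "\<not> g x - e \<le> ?u x"
    obtain c where c: "\<And>y. g x + c * (y - x) \<le> g y"
      using convex_supporting_line[OF g] by blast
    \<comment> \<open>the tangent at \<open>x\<close> of \<open>g\<close> minus the chord\<close>
    define l where "l y = g x - e + (c - \<kappa>) * (y - x)" for y
    have lg: "l y \<le> g y - (e + \<kappa> * (y - x))" for y
      using c[of y] by (simp add: l_def algebra_simps)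
    have la: "l a \<le> ?u a" and lb: "l b \<le> ?u b"
      using lg[of a] lg[of b] ea eb by simp_all
    have lx: "?u x < l x" using neg by (simp add: l_def)
    have "convex_on UNIV (\<lambda>y. - l y)"
      by (rule convex_onI) (simp_all add: l_def algebra_simps)
    then have h: "convex_on UNIV (\<lambda>y. ?u y - l y)"
      using convex_on_add[OF u, of "\<lambda>y. - l y"] by simp
    have sub: "l p \<le> ?D p" for p
    proof (cases "p \<in> closed_segment a b")
      case True
      then obtain s where s: "0 \<le> s" "s \<le> 1" "p = (1 - s) * a + s * b"
        by (auto simp: closed_segment_def)
      have "f p \<le> (1 - s) * f a + s * f b"
        using convex_onD[OF f, of s a b] s by simp
      also have "\<dots> \<le> (1 - s) * (g a - ?u a) + s * (g b - ?u b)"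
        using s convex_minorant_le[OF fb, of a] convex_minorant_le[OF fb, of b]
        by (intro add_mono mult_left_mono) auto
      also have "\<dots> = e + \<kappa> * (p - x)"
        unfolding ea[symmetric] eb[symmetric] s(3) by (simp add: algebra_simps)
      finally show ?thesis using lg[of p] by simp
    next
      case False
      then have "p < a \<or> b < p"
        using ab by (auto simp: closed_segment_eq_real_ivl)
      then have "a \<in> closed_segment p x \<or> b \<in> closed_segment p x"
        using axb by (auto simp: closed_segment_eq_real_ivl)
      then have "0 \<le> ?u p - l p"
        using convex_nonneg_beyond[OF h, of x] la lb lx by auto
      then show ?thesis using convex_minorant_le[OF fb, of p] by simp
    qed
    have "affine_below ?D (c - \<kappa>) (g x - e - (c - \<kappa>) * x)"
      unfolding affine_below_def
    proof
      fix p show "(c - \<kappa>) * p + (g x - e - (c - \<kappa>) * x) \<le> ?D p"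
        using sub[of p] by (simp add: l_def algebra_simps)
    qed
    from affine_le_convex_minorant[OF this, of x] lx show False
      by (simp add: l_def)
  qed
  then show "g ((1 - t) *\<^sub>R a + t *\<^sub>R b) - ?u ((1 - t) *\<^sub>R a + t *\<^sub>R b)
      \<le> (1 - t) * (g a - ?u a) + t * (g b - ?u b)"
    by (simp add: x_def e_def)
qed simp

section \<open>Total variation\<close>

text \<open>
  For \<open>h\<close> vanishing at \<open>-\<infinity>\<close>, this says that the total variation of \<open>h\<close> is at most \<open>C\<close>, in the form of
  a Jordan decomposition. In general a bound on the limit at \<open>-\<infinity>\<close> is included.
\<close>

definition variation_le :: "(real \<Rightarrow> real) \<Rightarrow> real \<Rightarrow> bool" where
  "variation_le h C \<longleftrightarrow> (\<exists>p n. mono p \<and> mono n \<and>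
     (\<forall>x. 0 \<le> p x \<and> 0 \<le> n x \<and> h x = p x - n x \<and> p x + n x \<le> C))"

lemma variation_leI:
  assumes "\<And>x y. x \<le> y \<Longrightarrow> p x \<le> p y" "\<And>x y. x \<le> y \<Longrightarrow> n x \<le> n y"
    and "\<And>x. 0 \<le> p x" "\<And>x. 0 \<le> n x" "\<And>x. h x = p x - n x" "\<And>x. p x + n x \<le> C"
  shows "variation_le h C"
  unfolding variation_le_def
  by (intro exI[of _ p] exI[of _ n] conjI allI monoI) (use assms in simp_all)

lemma variation_leE:
  assumes "variation_le h C"
  obtains p n where "\<And>x y. x \<le> y \<Longrightarrow> p x \<le> p y" "\<And>x y. x \<le> y \<Longrightarrow> n x \<le> n y"
    and "\<And>x. 0 \<le> p x" "\<And>x. 0 \<le> n x" "\<And>x. h x = p x - n x" "\<And>x. p x + n x \<le> C"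
  using assms unfolding variation_le_def mono_def by metis

lemma variation_le_diff:
  assumes "variation_le g C" "variation_le h D"
  shows "variation_le (\<lambda>x. g x - h x) (C + D)"
proof -
  obtain p n where g: "\<And>x y. x \<le> y \<Longrightarrow> p x \<le> p y" "\<And>x y. x \<le> y \<Longrightarrow> n x \<le> n y"
    "\<And>x. 0 \<le> p x" "\<And>x. 0 \<le> n x" "\<And>x. g x = p x - n x" "\<And>x. p x + n x \<le> C"
    using variation_leE[OF assms(1)] by blast
  obtain q m where h: "\<And>x y. x \<le> y \<Longrightarrow> q x \<le> q y" "\<And>x y. x \<le> y \<Longrightarrow> m x \<le> m y"
    "\<And>x. 0 \<le> q x" "\<And>x. 0 \<le> m x" "\<And>x. h x = q x - m x" "\<And>x. q x + m x \<le> D"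
    using variation_leE[OF assms(2)] by blast
  show ?thesis
  proof (rule variation_leI[of "\<lambda>x. p x + m x" "\<lambda>x. n x + q x"])
    fix x
    show "g x - h x = p x + m x - (n x + q x)" "p x + m x + (n x + q x) \<le> C + D"
      using g(5,6)[of x] h(5,6)[of x] by linarith+
  qed (auto intro: add_mono add_nonneg_nonneg g h)
qed

text \<open>
  The key estimate: taking convex minorants does not increase the total variation of a difference.
  Write \<open>f - g = p - n\<close> and compare both functions with \<open>k = g + p = f + n\<close>. By
  \<open>convex_minorant_diff_mono\<close> the convex minorant of \<open>k\<close> exceeds that of \<open>g\<close> by a nondecreasing
  function, which has values between \<open>0\<close> and \<open>sup p\<close>, and that of \<open>f\<close> by a nondecreasing function
  with values between \<open>0\<close> and \<open>sup n\<close>.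
\<close>

lemma variation_le_convex_minorant:
  assumes f: "affine_below f a0 b0" and g: "affine_below g a1 b1"
    and var: "variation_le (\<lambda>x. f x - g x) C"
  shows "variation_le (\<lambda>x. convex_minorant f x - convex_minorant g x) C"
proof -
  obtain p n where pn: "\<And>x y. x \<le> y \<Longrightarrow> p x \<le> p y" "\<And>x y. x \<le> y \<Longrightarrow> n x \<le> n y"
    "\<And>x. 0 \<le> p x" "\<And>x. 0 \<le> n x" "\<And>x. f x - g x = p x - n x" "\<And>x. p x + n x \<le> C"
    using variation_leE[OF var] by blast
  define k where "k x = g x + p x" for x
  have kf: "k x = f x + n x" for x using pn(5)[of x] by (simp add: k_def)
  have k: "affine_below k a1 b1"
    using g pn(3) unfolding affine_below_def k_def by (smt (verit))
  have sum: "p x + n y \<le> C" for x y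
    using pn(1)[of x "max x y"] pn(2)[of y "max x y"] pn(6)[of "max x y"] by linarith
  define P where "P = (SUP x. p x)"
  have pP: "p x \<le> P" for x
    unfolding P_def
  proof (intro cSUP_upper bdd_aboveI2[of _ _ C])
    show "p x \<le> C" for x using pn(4,6)[of x] by linarith
  qed simp
  have nP: "n x \<le> C - P" for x
  proof -
    have "P \<le> C - n x" unfolding P_def
      by (rule cSUP_least) (use sum in \<open>auto simp: le_diff_eq\<close>)
    then show ?thesis by simp
  qed
  let ?c = convex_minorant
  show ?thesis
  proof (rule variation_leI[of "\<lambda>x. ?c k x - ?c g x" "\<lambda>x. ?c k x - ?c f x"])
    fix x y :: real assume "x \<le> y"
    then show "?c k x - ?c g x \<le> ?c k y - ?c g y"
      by (rule convex_minorant_diff_mono[OF k g, rotated]) (simp add: k_def pn(1))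
    show "?c k x - ?c f x \<le> ?c k y - ?c f y"
      using \<open>x \<le> y\<close> by (rule convex_minorant_diff_mono[OF k f, rotated]) (simp add: kf pn(2))
  next
    fix x
    show "0 \<le> ?c k x - ?c g x"
      using convex_minorant_le_shift[OF g, of k 0 x] pn(3) by (simp add: k_def)
    show "0 \<le> ?c k x - ?c f x"
      using convex_minorant_le_shift[OF f, of k 0 x] pn(4) by (simp add: kf)
    have "?c k x \<le> ?c g x + P"
      by (rule convex_minorant_le_shift[OF k]) (simp add: k_def pP)
    moreover have "?c k x \<le> ?c f x + (C - P)"
      by (rule convex_minorant_le_shift[OF k]) (use nP in \<open>simp add: kf\<close>)
    ultimately show "?c k x - ?c g x + (?c k x - ?c f x) \<le> C" by simp
  qed simp
qed

section \<open>The Kantorovich distance as a total variation\<close>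

lemma kantorovich_upper:
  assumes "\<mu> \<in> first_moment_measures" "\<nu> \<in> first_moment_measures"
    and "measure \<mu> UNIV = measure \<nu> UNIV" "1-lipschitz_on UNIV f"
  shows "(\<integral>x. f x \<partial>\<mu>) - (\<integral>x. f x \<partial>\<nu>) \<le> kantorovich \<mu> \<nu>"
proof -
  have "\<bar>(\<integral>x. f x \<partial>\<mu>) - (\<integral>x. f x \<partial>\<nu>)\<bar> \<le> kantorovich \<mu> \<nu>"
    unfolding kantorovich_def
    by (rule cSUP_upper[OF _ bdd_above_kantorovich[OF assms(1-3)]]) (use assms(4) in simp)
  then show ?thesis by simp
qed

lemma lipschitz_real_iff:
  fixes f :: "real \<Rightarrow> real"
  shows "1-lipschitz_on UNIV f \<longleftrightarrow> (\<forall>s t. s \<le> t \<longrightarrow> \<bar>f t - f s\<bar> \<le> t - s)"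
proof
  show "\<forall>s t. s \<le> t \<longrightarrow> \<bar>f t - f s\<bar> \<le> t - s" if "1-lipschitz_on UNIV f"
  proof (intro allI impI)
    fix s t :: real assume "s \<le> t"
    then show "\<bar>f t - f s\<bar> \<le> t - s"
      using lipschitz_onD[OF that, of t s] by (simp add: dist_real_def)
  qed
  assume *: "\<forall>s t. s \<le> t \<longrightarrow> \<bar>f t - f s\<bar> \<le> t - s"
  show "1-lipschitz_on UNIV f"
  proof (rule lipschitz_onI)
    fix x y :: real
    show "dist (f x) (f y) \<le> 1 * dist x y"
      using *[rule_format, of x y] *[rule_format, of y x] 
      by (cases "x \<le> y") (auto simp: dist_real_def)
  qed simp
qed

text \<open>
  In terms of distribution functions, the total variation of the difference of the potential
  functions is the \<open>L\<^sup>1\<close> distance of the distribution functions, which is the Kantorovich distance.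
  Here the Jordan decomposition is obtained directly from the test functions: \<open>p x\<close> is the supremum
  of \<open>I \<phi>\<close>, the difference of the two integrals, over the functions \<open>\<phi>\<close> with slopes in \<open>[-1, 0]\<close> that
  vanish on \<open>[x, \<infinity>)\<close>. The hinge at \<open>x\<close> is one of them, and passing from the class at \<open>x\<close> to that at
  \<open>y \<ge> x\<close> by adding the difference of the hinges shows that \<open>p\<close> minus the potential difference is
  nondecreasing. For two members \<open>\<phi>\<close>, \<open>\<psi>\<close> of the class, \<open>\<phi> + \<psi>\<close> minus the hinge has slopes in
  \<open>[-1, 1]\<close>, which bounds the sum of both parts by the Kantorovich distance.
\<close>

lemma variation_le_kantorovich:
  assumes \<mu>: "\<mu> \<in> first_moment_measures" and \<nu>: "\<nu> \<in> first_moment_measures"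
    and mass: "measure \<mu> UNIV = measure \<nu> UNIV"
  shows "variation_le (\<lambda>x. put \<mu> x - put \<nu> x) (kantorovich \<mu> \<nu>)"
proof -
  define K where "K = kantorovich \<mu> \<nu>"
  define I where "I f = (\<integral>x. f x \<partial>\<mu>) - (\<integral>x. f x \<partial>\<nu>)" for f :: "real \<Rightarrow> real"
  define hinge :: "real \<Rightarrow> real \<Rightarrow> real" where "hinge x t = max 0 (x - t)" for x t
  define \<Phi> where "\<Phi> x = {\<phi> :: real \<Rightarrow> real. (\<forall>s t. s \<le> t \<longrightarrow> 0 \<le> \<phi> s - \<phi> t \<and> \<phi> s - \<phi> t \<le> t - s)
     \<and> (\<forall>t\<ge>x. \<phi> t = 0)}" for x
  have I_le: "I f \<le> K" if "1-lipschitz_on UNIV f" for f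
    unfolding I_def K_def by (rule kantorovich_upper[OF \<mu> \<nu> mass that])
  have lip: "1-lipschitz_on UNIV \<phi>" if "\<phi> \<in> \<Phi> x" for \<phi> x
    using that unfolding \<Phi>_def lipschitz_real_iff by force
  have int: "integrable \<mu> \<phi>" "integrable \<nu> \<phi>" if "1-lipschitz_on UNIV \<phi>" for \<phi> :: "real \<Rightarrow> real"
    by (rule integrable_lipschitz[OF \<mu> that], rule integrable_lipschitz[OF \<nu> that])
  have hinge: "hinge x \<in> \<Phi> x" for x unfolding \<Phi>_def hinge_def by auto
  have I_hinge: "I (hinge x) = put \<mu> x - put \<nu> x" for x by (simp add: I_def hinge_def put_def)
  have zero: "(\<lambda>_. 0) \<in> \<Phi> x" for x unfolding \<Phi>_def by auto
  have I_zero: "I (\<lambda>_. 0) = 0" by (simp add: I_def)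
  have mono\<Phi>: "\<Phi> x \<subseteq> \<Phi> y" if "x \<le> y" for x y using that unfolding \<Phi>_def by auto
  have slope: "0 \<le> \<phi> s - \<phi> t \<and> \<phi> s - \<phi> t \<le> t - s" if "\<phi> \<in> \<Phi> x" "s \<le> t" for \<phi> x s t
    using that unfolding \<Phi>_def by blast
  have vanish: "\<phi> t = 0" if "\<phi> \<in> \<Phi> x" "x \<le> t" for \<phi> x t
    using that unfolding \<Phi>_def by blast
  have shift: "(\<lambda>t. \<phi> t + hinge y t - hinge x t) \<in> \<Phi> y" if xy: "x \<le> y" and \<phi>: "\<phi> \<in> \<Phi> x" for x y \<phi>
    unfolding \<Phi>_def
  proof (intro CollectI conjI allI impI)
    fix s t :: real assume "s \<le> t"
    then have "0 \<le> \<phi> s - \<phi> t \<and> \<phi> s - \<phi> t \<le> t - s" "s \<le> x \<Longrightarrow> 0 \<le> \<phi> s - \<phi> x \<and> \<phi> s - \<phi> x \<le> x - s"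
      "x \<le> s \<Longrightarrow> \<phi> s = 0" "x \<le> t \<Longrightarrow> \<phi> t = 0" "\<phi> x = 0"
      using slope[OF \<phi>, of s t] slope[OF \<phi>, of s x] vanish[OF \<phi>, of s] vanish[OF \<phi>, of t]
        vanish[OF \<phi>, of x] \<open>s \<le> t\<close> by auto
    with \<open>s \<le> t\<close> xy show "0 \<le> \<phi> s + hinge y s - hinge x s - (\<phi> t + hinge y t - hinge x t)"
      "\<phi> s + hinge y s - hinge x s - (\<phi> t + hinge y t - hinge x t) \<le> t - s"
      unfolding hinge_def by (smt (verit))+
  next
    fix t assume "y \<le> t"
    then show "\<phi> t + hinge y t - hinge x t = 0" using xy \<phi> by (auto simp: \<Phi>_def hinge_def)
  qed
  have combine: "1-lipschitz_on UNIV (\<lambda>t. \<phi> t + \<psi> t - hinge x t)" if \<phi>: "\<phi> \<in> \<Phi> x" and \<psi>: "\<psi> \<in> \<Phi> x" for \<phi> \<psi> x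
    unfolding lipschitz_real_iff
  proof (intro allI impI)
    fix s t :: real assume "s \<le> t"
    moreover have "0 \<le> \<phi> s - \<phi> t \<and> \<phi> s - \<phi> t \<le> t - s" "s \<le> x \<Longrightarrow> 0 \<le> \<phi> s - \<phi> x \<and> \<phi> s - \<phi> x \<le> x - s"
      "x \<le> s \<Longrightarrow> \<phi> s = 0" "x \<le> t \<Longrightarrow> \<phi> t = 0" "\<phi> x = 0"
      using slope[OF \<phi>, of s t] slope[OF \<phi>, of s x] vanish[OF \<phi>, of s] vanish[OF \<phi>, of t]
        vanish[OF \<phi>, of x] \<open>s \<le> t\<close> by auto
    moreover have "0 \<le> \<psi> s - \<psi> t \<and> \<psi> s - \<psi> t \<le> t - s" "s \<le> x \<Longrightarrow> 0 \<le> \<psi> s - \<psi> x \<and> \<psi> s - \<psi> x \<le> x - s"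
      "x \<le> s \<Longrightarrow> \<psi> s = 0" "x \<le> t \<Longrightarrow> \<psi> t = 0" "\<psi> x = 0"
      using slope[OF \<psi>, of s t] slope[OF \<psi>, of s x] vanish[OF \<psi>, of s] vanish[OF \<psi>, of t]
        vanish[OF \<psi>, of x] \<open>s \<le> t\<close> by auto
    ultimately show "\<bar>\<phi> t + \<psi> t - hinge x t - (\<phi> s + \<psi> s - hinge x s)\<bar> \<le> t - s"
      unfolding hinge_def by (smt (verit))
  qed
  have I_add: "I (\<lambda>t. f t + g t - h t) = I f + I g - I h"
    if "1-lipschitz_on UNIV f" "1-lipschitz_on UNIV g" "1-lipschitz_on UNIV h" for f g h :: "real \<Rightarrow> real"
    unfolding I_def using int that by simp
  define p where "p x = (SUP \<phi>\<in>\<Phi> x. I \<phi>)" for x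
  have p_upper: "I \<phi> \<le> p x" if "\<phi> \<in> \<Phi> x" for \<phi> x
    unfolding p_def by (rule cSUP_upper[OF that bdd_aboveI2[of _ _ K]]) (rule I_le[OF lip])
  have p_least: "p x \<le> c" if "\<And>\<phi>. \<phi> \<in> \<Phi> x \<Longrightarrow> I \<phi> \<le> c" for x c
    unfolding p_def by (rule cSUP_least) (use zero that in auto)
  have "variation_le (\<lambda>x. I (hinge x)) K"
  proof (rule variation_leI[of p "\<lambda>x. p x - I (hinge x)"])
    fix x y :: real assume xy: "x \<le> y"
    show "p x \<le> p y"
      by (rule p_least) (use p_upper mono\<Phi>[OF xy] in blast)
    have "p x \<le> p y - I (hinge y) + I (hinge x)"
    proof (rule p_least)
      fix \<phi> assume \<phi>: "\<phi> \<in> \<Phi> x"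
      show "I \<phi> \<le> p y - I (hinge y) + I (hinge x)"
        using p_upper[OF shift[OF xy \<phi>]] by (subst (asm) I_add) (auto intro: lip \<phi> hinge)
    qed
    then show "p x - I (hinge x) \<le> p y - I (hinge y)" by simp
  next
    fix x
    show "0 \<le> p x" using p_upper[OF zero] I_zero by simp
    show "0 \<le> p x - I (hinge x)" using p_upper[OF hinge] by simp
    have "p x \<le> K + I (hinge x) - p x"
    proof (rule p_least)
      fix \<phi> assume \<phi>: "\<phi> \<in> \<Phi> x"
      have "p x \<le> K + I (hinge x) - I \<phi>"
      proof (rule p_least)
        fix \<psi> assume \<psi>: "\<psi> \<in> \<Phi> x"
        show "I \<psi> \<le> K + I (hinge x) - I \<phi>"
          using I_le[OF combine[OF \<phi> \<psi>]] by (subst (asm) I_add) (auto intro: lip \<phi> \<psi> hinge)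
      qed
      then show "I \<phi> \<le> K + I (hinge x) - p x" by simp
    qed
    then show "p x + (p x - I (hinge x)) \<le> K" by simp
  qed simp
  then show ?thesis by (simp add: I_hinge K_def)
qed

text \<open>
  The points of \<open>[-N, N]\<close> with spacing \<open>1 / N\<close>, for \<open>N = Suc n\<close>.
\<close>

definition grid :: "nat \<Rightarrow> nat \<Rightarrow> real" where
  "grid n i = real i / real (Suc n) - real (Suc n)"

definition grid_size :: "nat \<Rightarrow> nat" where
  "grid_size n = 2 * (Suc n)\<^sup>2"

definition grid_slope :: "(real \<Rightarrow> real) \<Rightarrow> nat \<Rightarrow> nat \<Rightarrow> real" where
  "grid_slope f n i = (f (grid n (Suc i)) - f (grid n i)) * real (Suc n)"

text \<open>
  The piecewise linear interpolation of \<open>f\<close> at the grid points, constant outside the grid, written in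
  terms of hinges so that its integral is a finite sum over increments of the potential function.
\<close>

definition interpolant :: "(real \<Rightarrow> real) \<Rightarrow> nat \<Rightarrow> real \<Rightarrow> real" where
  "interpolant f n x = f (grid n (grid_size n)) -
     (\<Sum>i<grid_size n. grid_slope f n i * (max 0 (grid n (Suc i) - x) - max 0 (grid n i - x)))"

lemma grid_step: "grid n (Suc i) - grid n i = 1 / real (Suc n)"
  unfolding grid_def by (simp add: add_divide_distrib)

lemma grid_mono: "i \<le> j \<Longrightarrow> grid n i \<le> grid n j"
  unfolding grid_def by (simp add: divide_right_mono)

lemma grid_0: "grid n 0 = - real (Suc n)" and grid_size: "grid n (grid_size n) = real (Suc n)"
  and grid_mid: "grid n ((Suc n)\<^sup>2) = 0"
  unfolding grid_def grid_size_def
  by (simp_all add: power2_eq_square del: of_nat_Suc mult_Suc mult_Suc_right)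

lemma interpolant_grid:
  assumes "j \<le> grid_size n"
  shows "interpolant f n (grid n j) = f (grid n j)"
proof -
  let ?N = "grid_size n"
  have "grid_slope f n i * (max 0 (grid n (Suc i) - grid n j) - max 0 (grid n i - grid n j))
      = (if j \<le> i then f (grid n (Suc i)) - f (grid n i) else 0)" for i
  proof (cases "j \<le> i")
    case True
    then have "max 0 (grid n (Suc i) - grid n j) - max 0 (grid n i - grid n j) = 1 / real (Suc n)"
      using grid_mono[of j i n] grid_mono[of j "Suc i" n] grid_step[of n i] by simp
    with True show ?thesis by (simp add: grid_slope_def del: of_nat_Suc)
  next
    case False
    then show ?thesis using grid_mono[of i j n] grid_mono[of "Suc i" j n] by simp
  qed
  then have "interpolant f n (grid n j) = f (grid n ?N) -
      (\<Sum>i<?N. if j \<le> i then f (grid n (Suc i)) - f (grid n i) else 0)"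
    by (simp add: interpolant_def)
  also have "(\<Sum>i<?N. if j \<le> i then f (grid n (Suc i)) - f (grid n i) else 0)
      = (\<Sum>i=j..<?N. f (grid n (Suc i)) - f (grid n i))"
    by (rule sum.mono_neutral_cong_right) auto
  also have "\<dots> = f (grid n ?N) - f (grid n j)"
    using assms by (rule sum_Suc_diff')
  finally show ?thesis by simp
qed

context
  fixes f :: "real \<Rightarrow> real" and L :: real
  assumes lip: "\<And>x y. \<bar>f x - f y\<bar> \<le> L * \<bar>x - y\<bar>"
begin

lemma lip_const_nonneg: "0 \<le> L"
  using lip[of 1 0] by simp

lemma abs_grid_slope_le: "\<bar>grid_slope f n i\<bar> \<le> L"
proof -
  have "\<bar>f (grid n (Suc i)) - f (grid n i)\<bar> \<le> L / real (Suc n)"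
    using lip[of "grid n (Suc i)" "grid n i"] grid_step[of n i] by (simp del: of_nat_Suc)
  then show ?thesis
    by (simp add: grid_slope_def abs_mult pos_le_divide_eq del: of_nat_Suc)
qed

text \<open>
  The differences of consecutive hinges are nonincreasing functions whose sum telescopes to a
  \<open>1\<close>-Lipschitz function, and their coefficients have size at most \<open>L\<close>.
\<close>

lemma interpolant_lip: "\<bar>interpolant f n x - interpolant f n y\<bar> \<le> L * \<bar>x - y\<bar>"
proof -
  have *: "\<bar>interpolant f n x - interpolant f n y\<bar> \<le> L * (y - x)" if "x \<le> y" for x y
  proof -
    define r where "r i = max 0 (grid n i - x) - max 0 (grid n i - y)" for i
    have r_mono: "r i \<le> r (Suc i)" for i
      using grid_mono[of i "Suc i" n] that unfolding r_def by linarith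
    have "interpolant f n x - interpolant f n y = - (\<Sum>i<grid_size n. grid_slope f n i * (r (Suc i) - r i))"
      unfolding interpolant_def r_def sum_negf[symmetric]
      by (simp add: sum_subtractf[symmetric] algebra_simps)
    also have "\<bar>\<dots>\<bar> \<le> (\<Sum>i<grid_size n. \<bar>grid_slope f n i * (r (Suc i) - r i)\<bar>)"
      by (simp only: abs_minus_cancel sum_abs)
    also have "\<dots> \<le> (\<Sum>i<grid_size n. L * (r (Suc i) - r i))"
      using r_mono by (intro sum_mono) (simp add: abs_mult mult_right_mono abs_grid_slope_le)
    also have "\<dots> = L * (r (grid_size n) - r 0)"
      by (simp add: sum_distrib_left[symmetric] sum_lessThan_telescope)
    also have "\<dots> \<le> L * (y - x)"
      using that lip_const_nonneg unfolding r_def by (intro mult_left_mono) linarith+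
    finally show ?thesis .
  qed
  show ?thesis
    using *[of x y] *[of y x] by (cases "x \<le> y") (auto simp: abs_minus_commute)
qed

lemma interpolant_error:
  assumes "\<bar>x\<bar> \<le> real (Suc n)"
  shows "\<bar>interpolant f n x - f x\<bar> \<le> 2 * L / real (Suc n)"
proof -
  let ?m = "real (Suc n)"
  define j where "j = nat \<lfloor>(x + ?m) * ?m\<rfloor>"
  have pos: "0 \<le> (x + ?m) * ?m" using assms by (intro mult_nonneg_nonneg) auto
  have le: "(x + ?m) * ?m \<le> (2 * ?m) * ?m" using assms by (intro mult_right_mono) auto
  have j: "real j \<le> (x + ?m) * ?m" "(x + ?m) * ?m < real j + 1"
    using pos unfolding j_def by linarith+
  have "real (grid_size n) = (2 * ?m) * ?m"
    by (simp add: grid_size_def power2_eq_square del: of_nat_Suc mult_Suc mult_Suc_right)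
  with j(1) le have "real j \<le> real (grid_size n)" by linarith
  then have jN: "j \<le> grid_size n" by simp
  have "real j / ?m \<le> x + ?m" "x + ?m \<le> (real j + 1) / ?m"
    using j by (simp_all add: pos_divide_le_eq pos_le_divide_eq del: of_nat_Suc)
  then have d: "\<bar>x - grid n j\<bar> \<le> 1 / ?m"
    unfolding grid_def by (simp add: add_divide_distrib abs_le_iff del: of_nat_Suc)
  have "\<bar>interpolant f n x - f x\<bar>
      \<le> \<bar>interpolant f n x - interpolant f n (grid n j)\<bar> + \<bar>f (grid n j) - f x\<bar>"
    unfolding interpolant_grid[OF jN] by linarith
  also have "\<dots> \<le> L * \<bar>x - grid n j\<bar> + L * \<bar>x - grid n j\<bar>"
    using interpolant_lip[of n x "grid n j"] lip[of "grid n j" x] by (simp add: abs_minus_commute)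
  also have "\<dots> \<le> L * (1 / ?m) + L * (1 / ?m)"
    by (intro add_mono mult_left_mono d lip_const_nonneg)
  finally show ?thesis by simp
qed

lemma interpolant_tendsto: "(\<lambda>n. interpolant f n x) \<longlonglongrightarrow> f x"
proof (rule LIM_zero_cancel, rule Lim_null_comparison)
  show "\<forall>\<^sub>F n in sequentially. norm (interpolant f n x - f x) \<le> 2 * L * inverse (real (Suc n))"
    using eventually_ge_at_top[of "nat \<lceil>\<bar>x\<bar>\<rceil>"]
  proof eventually_elim
    case (elim n)
    then have "\<bar>x\<bar> \<le> real (Suc n)" by linarith
    from interpolant_error[OF this] show ?case by (simp add: divide_inverse)
  qed
  show "(\<lambda>n. 2 * L * inverse (real (Suc n))) \<longlonglongrightarrow> 0"
    using tendsto_mult[OF tendsto_const LIMSEQ_inverse_real_of_nat, of "2 * L"] by simp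
qed

lemma abs_interpolant_le: "\<bar>interpolant f n x\<bar> \<le> \<bar>f 0\<bar> + L * \<bar>x\<bar>"
proof -
  have "(Suc n)\<^sup>2 \<le> grid_size n" by (simp add: grid_size_def)
  from interpolant_grid[OF this, of f] have "interpolant f n 0 = f 0" by (simp only: grid_mid)
  then show ?thesis using interpolant_lip[of n x 0] by simp
qed

lemma interpolant_measurable [measurable]: "interpolant f n \<in> borel_measurable borel"
  unfolding interpolant_def by measurable

text \<open>
  Dominated convergence: all interpolants agree with \<open>f\<close> at the grid point \<open>0\<close> and have its
  Lipschitz constant, so they share a bound of linear growth.
\<close>

lemma integral_interpolant_tendsto:
  assumes "\<mu> \<in> first_moment_measures"
  shows "(\<lambda>n. \<integral>x. interpolant f n x \<partial>\<mu>) \<longlonglongrightarrow> (\<integral>x. f x \<partial>\<mu>)"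
proof -
  interpret finite_measure \<mu> using assms by (rule first_moment_measuresD)
  have [measurable_cong]: "sets \<mu> = sets borel" by (rule first_moment_measuresD[OF assms])
  have fm[measurable]: "f \<in> borel_measurable borel"
    by (rule borel_measurable_LIMSEQ_real[OF interpolant_tendsto interpolant_measurable])
  show ?thesis
  proof (rule integral_dominated_convergence[where w = "\<lambda>x. \<bar>f 0\<bar> + L * \<bar>x\<bar>"])
    show "integrable \<mu> (\<lambda>x. \<bar>f 0\<bar> + L * \<bar>x\<bar>)"
      using first_moment_measuresD(5)[OF assms] by simp
    show "AE x in \<mu>. (\<lambda>n. interpolant f n x) \<longlonglongrightarrow> f x"
      by (rule AE_I2) (rule interpolant_tendsto)
    show "AE x in \<mu>. norm (interpolant f n x) \<le> \<bar>f 0\<bar> + L * \<bar>x\<bar>" for n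
      by (rule AE_I2) (use abs_interpolant_le in simp)
  qed measurable
qed

end

lemma integral_interpolant:
  assumes "\<mu> \<in> first_moment_measures"
  shows "(\<integral>x. interpolant f n x \<partial>\<mu>) = f (grid n (grid_size n)) * measure \<mu> UNIV -
     (\<Sum>i<grid_size n. grid_slope f n i * (put \<mu> (grid n (Suc i)) - put \<mu> (grid n i)))"
proof -
  interpret finite_measure \<mu> using assms by (rule first_moment_measuresD)
  show ?thesis
    unfolding interpolant_def put_def using integrable_hinge[OF assms] first_moment_measuresD(4)[OF assms]
    by (simp add: Bochner_Integration.integral_diff Bochner_Integration.integral_sum)
qed

lemma integral_diff_tendsto_put:
  assumes lip: "\<And>x y. \<bar>f x - f y\<bar> \<le> L * \<bar>x - y\<bar>"
    and \<mu>: "\<mu> \<in> first_moment_measures" and \<nu>: "\<nu> \<in> first_moment_measures"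
    and mass: "measure \<mu> UNIV = measure \<nu> UNIV"
  defines "\<Delta> \<equiv> \<lambda>k. put \<mu> k - put \<nu> k"
  shows "(\<lambda>n. - (\<Sum>i<grid_size n. grid_slope f n i * (\<Delta> (grid n (Suc i)) - \<Delta> (grid n i))))
     \<longlonglongrightarrow> (\<integral>x. f x \<partial>\<mu>) - (\<integral>x. f x \<partial>\<nu>)"
proof -
  have "(\<lambda>n. (\<integral>x. interpolant f n x \<partial>\<mu>) - (\<integral>x. interpolant f n x \<partial>\<nu>))
      \<longlonglongrightarrow> (\<integral>x. f x \<partial>\<mu>) - (\<integral>x. f x \<partial>\<nu>)"
    by (intro tendsto_diff integral_interpolant_tendsto[OF lip] \<mu> \<nu>)
  moreover have "(\<integral>x. interpolant f n x \<partial>\<mu>) - (\<integral>x. interpolant f n x \<partial>\<nu>)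
      = - (\<Sum>i<grid_size n. grid_slope f n i * (\<Delta> (grid n (Suc i)) - \<Delta> (grid n i)))" for n
    unfolding integral_interpolant[OF \<mu>] integral_interpolant[OF \<nu>] mass \<Delta>_def
      sum_negf[symmetric] by (simp add: sum_subtractf[symmetric] algebra_simps)
  ultimately show ?thesis by simp
qed

text \<open>
  By \<open>integral_diff_tendsto_put\<close> the difference of the integrals of a \<open>1\<close>-Lipschitz function is a limit
  of sums of increments of the potential difference, with coefficients in \<open>[-1, 1]\<close>.
\<close>

lemma kantorovich_le_variation:
  assumes \<mu>: "\<mu> \<in> first_moment_measures" and \<nu>: "\<nu> \<in> first_moment_measures"
    and mass: "measure \<mu> UNIV = measure \<nu> UNIV"
    and var: "variation_le (\<lambda>x. put \<mu> x - put \<nu> x) C"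
  shows "kantorovich \<mu> \<nu> \<le> C"
  unfolding kantorovich_def
proof (rule cSUP_least)
  have "1-lipschitz_on UNIV (\<lambda>x::real. 0::real)" by (rule lipschitz_onI) auto
  then show "{f::real \<Rightarrow> real. 1-lipschitz_on UNIV f} \<noteq> {}" by blast
next
  fix f :: "real \<Rightarrow> real" assume "f \<in> {f. 1-lipschitz_on UNIV f}"
  then have "dist (f x) (f y) \<le> 1 * dist x y" for x y
    by (intro lipschitz_onD[where X = UNIV]) auto
  then have lip: "\<bar>f x - f y\<bar> \<le> 1 * \<bar>x - y\<bar>" for x y by (simp add: dist_real_def)
  obtain p m where pm: "\<And>x y. x \<le> y \<Longrightarrow> p x \<le> p y" "\<And>x y. x \<le> y \<Longrightarrow> m x \<le> m y"
    "\<And>x. 0 \<le> p x" "\<And>x. 0 \<le> m x" "\<And>x. put \<mu> x - put \<nu> x = p x - m x" "\<And>x. p x + m x \<le> C"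
    using variation_leE[OF var] by blast
  let ?S = "\<lambda>n. - (\<Sum>i<grid_size n. grid_slope f n i *
    ((put \<mu> (grid n (Suc i)) - put \<nu> (grid n (Suc i))) - (put \<mu> (grid n i) - put \<nu> (grid n i))))"
  have "\<bar>?S n\<bar> \<le> C" for n
  proof -
    define q where "q i = p (grid n i) + m (grid n i)" for i
    have "\<bar>?S n\<bar> \<le> (\<Sum>i<grid_size n. \<bar>grid_slope f n i * ((p (grid n (Suc i)) - m (grid n (Suc i)))
        - (p (grid n i) - m (grid n i)))\<bar>)"
      unfolding abs_minus_cancel pm(5) by (rule sum_abs)
    also have "\<dots> \<le> (\<Sum>i<grid_size n. q (Suc i) - q i)"
    proof (rule sum_mono)
      fix i
      have "\<bar>grid_slope f n i * ((p (grid n (Suc i)) - m (grid n (Suc i))) - (p (grid n i) - m (grid n i)))\<bar>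
          \<le> 1 * \<bar>(p (grid n (Suc i)) - m (grid n (Suc i))) - (p (grid n i) - m (grid n i))\<bar>"
        unfolding abs_mult by (intro mult_right_mono abs_grid_slope_le[OF lip]) simp
      also have "\<dots> \<le> q (Suc i) - q i"
        using pm(1,2)[OF grid_mono[of i "Suc i" n]] unfolding q_def by simp
      finally show "\<bar>grid_slope f n i * ((p (grid n (Suc i)) - m (grid n (Suc i)))
        - (p (grid n i) - m (grid n i)))\<bar> \<le> q (Suc i) - q i" .
    qed
    also have "\<dots> = q (grid_size n) - q 0" by (rule sum_lessThan_telescope)
    also have "\<dots> \<le> C"
      using pm(3,4)[of "grid n 0"] pm(6)[of "grid n (grid_size n)"] unfolding q_def by linarith
    finally show ?thesis .
  qed
  then show "\<bar>(\<integral>x. f x \<partial>\<mu>) - (\<integral>x. f x \<partial>\<nu>)\<bar> \<le> C"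
    by (intro LIMSEQ_le_const2[OF tendsto_rabs[OF integral_diff_tendsto_put[OF lip \<mu> \<nu> mass]]]) auto
qed

section \<open>The convex order as the order of potential functions\<close>

text \<open>
  The one-sided derivatives of a convex function are bounded by its growth rates at \<open>\<plusminus>\<infinity>\<close>.
\<close>

lemma convex_linear_growth_lipschitz:
  assumes conv: "convex_on UNIV \<phi>" and growth: "linear_growth \<phi>"
  obtains L where "\<And>x y. \<bar>\<phi> x - \<phi> y\<bar> \<le> L * \<bar>x - y\<bar>"
proof -
  obtain a b where ab: "\<And>x. \<bar>\<phi> x\<bar> \<le> a + b * \<bar>x\<bar>"
    using growth unfolding linear_growth_def by blast
  have one: "\<phi> y - \<phi> x \<le> b * (y - x)" if "x < y" for x y
  proof -
    have "\<forall>\<^sub>F z in at_top. right_slope \<phi> y \<le> (a + b * z - \<phi> y) / (z - y)"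
      using eventually_gt_at_top[of "max 0 y"]
    proof eventually_elim
      case (elim z)
      then have "right_slope \<phi> y \<le> (\<phi> z - \<phi> y) / (z - y)"
        by (intro right_slope_bounds(1)[OF conv]) simp
      also have "\<dots> \<le> (a + b * z - \<phi> y) / (z - y)"
        using ab[of z] elim by (intro divide_right_mono) auto
      finally show ?case .
    qed
    moreover have "((\<lambda>z. (a + b * z - \<phi> y) / (z - y)) \<longlongrightarrow> b) at_top" by real_asymp
    ultimately have "right_slope \<phi> y \<le> b" by (intro tendsto_lowerbound) auto
    then have "(\<phi> y - \<phi> x) / (y - x) \<le> b"
      using right_slope_bounds(2)[OF conv that] by simp
    then show ?thesis using that by (simp add: pos_divide_le_eq)
  qed
  have two: "\<phi> x - \<phi> y \<le> b * (y - x)" if "x < y" for x y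
  proof -
    have "\<forall>\<^sub>F z in at_bot. (a - b * z - \<phi> x) / (z - x) \<le> right_slope \<phi> x"
      using eventually_gt_at_bot[of "min 0 x"]
    proof eventually_elim
      case (elim z)
      have "(a - b * z - \<phi> x) / (z - x) \<le> (\<phi> z - \<phi> x) / (z - x)"
        using ab[of z] elim by (intro divide_right_mono_neg) auto
      also have "\<dots> = (\<phi> x - \<phi> z) / (x - z)" by (metis minus_diff_eq minus_divide_divide)
      also have "\<dots> \<le> right_slope \<phi> x"
        using elim by (intro right_slope_bounds(2)[OF conv]) simp
      finally show ?case .
    qed
    moreover have "((\<lambda>z. (a - b * z - \<phi> x) / (z - x)) \<longlongrightarrow> - b) at_bot" by real_asymp
    ultimately have "- b \<le> right_slope \<phi> x" by (intro tendsto_upperbound) auto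
    then have "- b \<le> (\<phi> y - \<phi> x) / (y - x)"
      using right_slope_bounds(1)[OF conv that] by simp
    then show ?thesis using that by (simp add: pos_le_divide_eq)
  qed
  have "\<bar>\<phi> x - \<phi> y\<bar> \<le> b * \<bar>x - y\<bar>" for x y
    using one[of x y] two[of x y] one[of y x] two[of y x] by (cases x y rule: linorder_cases) auto
  then show ?thesis using that by blast
qed

text \<open>
  Summation by parts; the interior terms \<open>(s (i - 1) - s i) * D i\<close> are nonpositive and dropped.
\<close>

lemma sum_mono_slopes_le:
  fixes s D :: "nat \<Rightarrow> real"
  assumes "\<And>i. s i \<le> s (Suc i)" "\<And>i. 0 \<le> D i"
  shows "(\<Sum>i<Suc N. s i * (D (Suc i) - D i)) \<le> s N * D (Suc N) - s 0 * D 0"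
proof (induction N)
  case (Suc N)
  have "s N * D (Suc N) \<le> s (Suc N) * D (Suc N)"
    using assms by (intro mult_right_mono) auto
  with Suc show ?case by (simp add: right_diff_distrib)
qed (simp add: right_diff_distrib)

text \<open>
  A convex function is, up to affine functions, a mixture of hinges with positive weights. Concretely,
  summation by parts turns the sums of \<open>integral_diff_tendsto_put\<close> into values of the potential
  difference weighted by the nonnegative increments of the slopes, up to boundary terms. These
  vanish in the limit since equal mass and mean give both potential functions the same asymptotes.
\<close>

lemma convex_order_if_put_le:
  assumes \<mu>: "\<mu> \<in> first_moment_measures" and \<nu>: "\<nu> \<in> first_moment_measures"
    and mass: "measure \<mu> UNIV = measure \<nu> UNIV" and mean: "(\<integral>x. x \<partial>\<mu>) = (\<integral>x. x \<partial>\<nu>)"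
    and le: "\<And>k. put \<mu> k \<le> put \<nu> k"
  shows "convex_order \<mu> \<nu>"
  unfolding convex_order_def
proof (intro allI impI, elim conjE)
  fix \<phi> :: "real \<Rightarrow> real" assume conv: "convex_on UNIV \<phi>" and growth: "linear_growth \<phi>"
  obtain L where lip: "\<And>x y. \<bar>\<phi> x - \<phi> y\<bar> \<le> L * \<bar>x - y\<bar>"
    using convex_linear_growth_lipschitz[OF conv growth] by blast
  let ?\<Delta> = "\<lambda>k. put \<nu> k - put \<mu> k"
  have "filterlim (\<lambda>n. - real (Suc n)) at_bot sequentially" by real_asymp
  moreover have "(?\<Delta> \<longlongrightarrow> 0) at_bot"
    using tendsto_diff[OF tendsto_put_at_bot[OF \<nu>] tendsto_put_at_bot[OF \<mu>]] by simp
  ultimately have bot: "(\<lambda>n. ?\<Delta> (grid n 0)) \<longlonglongrightarrow> 0"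
    unfolding grid_0 by (rule filterlim_compose[rotated])
  have "filterlim (\<lambda>n. real (Suc n)) at_top sequentially" by real_asymp
  moreover have "(?\<Delta> \<longlongrightarrow> 0) at_top"
    using tendsto_diff[OF tendsto_put_at_top[OF \<nu>] tendsto_put_at_top[OF \<mu>]] mass mean by simp
  ultimately have top: "(\<lambda>n. ?\<Delta> (grid n (grid_size n))) \<longlonglongrightarrow> 0"
    unfolding grid_size by (rule filterlim_compose[rotated])
  have slope: "grid_slope \<phi> n i \<le> grid_slope \<phi> n (Suc i)" for n i
  proof -
    let ?a = "grid n i" and ?b = "grid n (Suc i)" and ?c = "grid n (Suc (Suc i))"
    have "?a < ?b" "?b < ?c"
      using grid_step[of n i] grid_step[of n "Suc i"] by (smt (verit) divide_pos_pos of_nat_0_less_iff zero_less_Suc)+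
    then have "(\<phi> ?b - \<phi> ?a) / (?b - ?a) \<le> (\<phi> ?c - \<phi> ?b) / (?c - ?b)"
      using right_slope_bounds[OF conv] order_trans by blast
    then show ?thesis by (simp add: grid_step grid_slope_def del: of_nat_Suc)
  qed
  have bound: "- (L * (?\<Delta> (grid n 0) + ?\<Delta> (grid n (grid_size n))))
      \<le> - (\<Sum>i<grid_size n. grid_slope \<phi> n i * (?\<Delta> (grid n (Suc i)) - ?\<Delta> (grid n i)))" for n
  proof -
    obtain N where N: "grid_size n = Suc N"
      by (metis grid_size_def not0_implies_Suc mult_eq_0_iff power_eq_0_iff zero_neq_numeral nat.distinct(1))
    have "(\<Sum>i<grid_size n. grid_slope \<phi> n i * (?\<Delta> (grid n (Suc i)) - ?\<Delta> (grid n i)))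
        \<le> grid_slope \<phi> n N * ?\<Delta> (grid n (Suc N)) - grid_slope \<phi> n 0 * ?\<Delta> (grid n 0)"
      unfolding N by (rule sum_mono_slopes_le) (use slope le in auto)
    also have "\<dots> \<le> L * ?\<Delta> (grid n (Suc N)) + L * ?\<Delta> (grid n 0)"
      unfolding diff_conv_add_uminus minus_mult_left
      using abs_grid_slope_le[of \<phi> L n N, OF lip] abs_grid_slope_le[of \<phi> L n 0, OF lip] le
      by (intro add_mono mult_right_mono) (auto simp: abs_le_iff)
    finally show ?thesis by (simp add: N algebra_simps)
  qed
  have "(\<lambda>n. - (L * (?\<Delta> (grid n 0) + ?\<Delta> (grid n (grid_size n))))) \<longlonglongrightarrow> - (L * (0 + 0))"
    by (intro tendsto_intros bot top)
  from LIMSEQ_le[OF this integral_diff_tendsto_put[OF lip \<nu> \<mu> mass[symmetric]]] bound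
  show "(\<integral>x. \<phi> x \<partial>\<mu>) \<le> (\<integral>x. \<phi> x \<partial>\<nu>)" by auto
qed

lemma linear_growth_hinge: "linear_growth (\<lambda>x. max 0 (k - x))" "linear_growth (\<lambda>x. max 0 (x - k))"
proof -
  have "\<bar>max 0 (k - x)\<bar> \<le> \<bar>k\<bar> + 1 * \<bar>x\<bar>" "\<bar>max 0 (x - k)\<bar> \<le> \<bar>k\<bar> + 1 * \<bar>x\<bar>" for x by linarith+
  then show "linear_growth (\<lambda>x. max 0 (k - x))" "linear_growth (\<lambda>x. max 0 (x - k))"
    unfolding linear_growth_def by blast+
qed

text \<open>
  Both an affine function and its negative are convex.
\<close>

lemma convex_order_affine:
  assumes "convex_order \<mu> \<nu>"
  shows "(\<integral>x. a * x + b \<partial>\<mu>) = (\<integral>x. a * x + b \<partial>\<nu>)"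
proof -
  have le: "(\<integral>x. a * x + b \<partial>\<mu>) \<le> (\<integral>x. a * x + b \<partial>\<nu>)" for a b
  proof -
    have "convex_on UNIV (\<lambda>x. a * x + b)" by (rule convex_onI) (simp_all add: algebra_simps)
    moreover have "\<bar>a * x + b\<bar> \<le> \<bar>b\<bar> + \<bar>a\<bar> * \<bar>x\<bar>" for x
      using abs_triangle_ineq[of "a * x" b] by (simp add: abs_mult)
    then have "linear_growth (\<lambda>x. a * x + b)" unfolding linear_growth_def by blast
    ultimately show ?thesis using assms unfolding convex_order_def by blast
  qed
  have "(\<integral>x. (- a) * x + (- b) \<partial>\<rho>) = - (\<integral>x. a * x + b \<partial>\<rho>)" for \<rho>
    by (subst integral_minus[symmetric]) simp
  with le[of a b] le[of "- a" "- b"] show ?thesis by simp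
qed

lemma convex_orderD:
  assumes order: "convex_order \<mu> \<nu>" and \<mu>: "\<mu> \<in> first_moment_measures" and \<nu>: "\<nu> \<in> first_moment_measures"
  shows "put \<mu> k \<le> put \<nu> k" "measure \<mu> UNIV = measure \<nu> UNIV" "(\<integral>x. x \<partial>\<mu>) = (\<integral>x. x \<partial>\<nu>)"
proof -
  show "put \<mu> k \<le> put \<nu> k"
    using order convex_on_hinge(1)[of k] linear_growth_hinge(1)[of k] by (simp add: convex_order_def put_def)
  show "measure \<mu> UNIV = measure \<nu> UNIV"
    using convex_order_affine[OF order, of 0 1] first_moment_measuresD(4)[OF \<mu>] first_moment_measuresD(4)[OF \<nu>] by simp
  show "(\<integral>x. x \<partial>\<mu>) = (\<integral>x. x \<partial>\<nu>)"
    using convex_order_affine[OF order, of 1 0] by simp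
qed

lemma convex_order_iff_put_le:
  assumes \<mu>: "\<mu> \<in> first_moment_measures" and \<nu>: "\<nu> \<in> first_moment_measures"
  shows "convex_order \<mu> \<nu> \<longleftrightarrow> measure \<mu> UNIV = measure \<nu> UNIV \<and> (\<integral>x. x \<partial>\<mu>) = (\<integral>x. x \<partial>\<nu>)
    \<and> (\<forall>k. put \<mu> k \<le> put \<nu> k)"
  using convex_orderD[OF _ \<mu> \<nu>] convex_order_if_put_le[OF \<mu> \<nu>] by blast

section \<open>Domination and sums of measures\<close>

lemma nn_integral_mono_setwise_order:
  assumes order: "setwise_order \<eta> \<nu>" and sets: "sets \<eta> = sets borel" "sets \<nu> = sets borel"
  shows "(\<integral>\<^sup>+x. f x \<partial>\<eta>) \<le> (\<integral>\<^sup>+x. f x \<partial>\<nu>)"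
proof -
  have sp: "space \<eta> = space \<nu>" using sets sets_eq_imp_space_eq by metis
  show ?thesis
    unfolding nn_integral_def
  proof (rule SUP_mono)
    fix g assume "g \<in> {g. simple_function \<eta> g \<and> g \<le> f}"
    then have g: "simple_function \<eta> g" "g \<le> f" by auto
    have g': "simple_function \<nu> g"
      using g(1) sets sp by (simp add: simple_function_def)
    have "integral\<^sup>S \<eta> g \<le> integral\<^sup>S \<nu> g"
      unfolding simple_integral_def sp
    proof (intro sum_mono mult_left_mono)
      fix x assume "x \<in> g ` space \<nu>"
      have "g -` {x} \<inter> space \<nu> \<in> sets borel"
        using simple_functionD(2)[OF g', of "{x}"] sets by simp
      then show "emeasure \<eta> (g -` {x} \<inter> space \<nu>) \<le> emeasure \<nu> (g -` {x} \<inter> space \<nu>)"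
        using order by (simp add: setwise_order_def)
    qed simp
    with g g' show "\<exists>h\<in>{g. simple_function \<nu> g \<and> g \<le> f}. integral\<^sup>S \<eta> g \<le> integral\<^sup>S \<nu> h"
      by blast
  qed
qed

lemma integral_mono_setwise_order:
  fixes f :: "real \<Rightarrow> real"
  assumes order: "setwise_order \<eta> \<nu>" and sets: "sets \<eta> = sets borel" "sets \<nu> = sets borel"
    and int: "integrable \<nu> f" and nonneg: "\<And>x. 0 \<le> f x"
  shows "(\<integral>x. f x \<partial>\<eta>) \<le> (\<integral>x. f x \<partial>\<nu>)"
proof -
  have m: "f \<in> borel_measurable \<eta>" "f \<in> borel_measurable \<nu>"
    using borel_measurable_integrable[OF int] measurable_cong_sets[of \<eta> \<nu> borel borel] sets by auto
  have fin: "(\<integral>\<^sup>+x. ennreal (f x) \<partial>\<nu>) < \<infinity>"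
    using integrableD(2)[OF int] nonneg by (simp add: top.not_eq_extremum)
  show ?thesis
    unfolding integral_eq_nn_integral[OF m(1) AE_I2[OF nonneg]] integral_eq_nn_integral[OF m(2) AE_I2[OF nonneg]]
    by (rule enn2real_mono[OF nn_integral_mono_setwise_order[OF order sets]]) (use fin in simp)
qed

text \<open>
  The difference is the potential function of the positive measure \<open>\<nu> - \<eta>\<close>. Instead of forming
  that measure, the domination is applied to the nonnegative convexity defect of the hinges.
\<close>

lemma convex_on_put_diff:
  assumes \<eta>: "\<eta> \<in> first_moment_measures" and \<nu>: "\<nu> \<in> first_moment_measures" and order: "setwise_order \<eta> \<nu>"
  shows "convex_on UNIV (\<lambda>k. put \<nu> k - put \<eta> k)"
proof (rule convex_onI)
  fix t a b :: real assume t: "0 < t" "t < 1"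
  define c where "c = (1 - t) *\<^sub>R a + t *\<^sub>R b"
  let ?\<psi> = "\<lambda>x. (1 - t) * max 0 (a - x) + t * max 0 (b - x) - max 0 (c - x)"
  have int: "integrable \<rho> ?\<psi>" "(\<integral>x. ?\<psi> x \<partial>\<rho>) = (1 - t) * put \<rho> a + t * put \<rho> b - put \<rho> c"
    if "\<rho> \<in> first_moment_measures" for \<rho>
    using integrable_hinge[OF that] by (simp_all add: put_def)
  have "(\<integral>x. ?\<psi> x \<partial>\<eta>) \<le> (\<integral>x. ?\<psi> x \<partial>\<nu>)"
  proof (rule integral_mono_setwise_order[OF order])
    show "0 \<le> ?\<psi> x" for x
      using convex_onD[OF convex_on_hinge(2)[of x], of t a b] t by (simp add: c_def)
  qed (use int \<nu> first_moment_measuresD(3) \<eta> in auto)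
  then show "put \<nu> ((1 - t) *\<^sub>R a + t *\<^sub>R b) - put \<eta> ((1 - t) *\<^sub>R a + t *\<^sub>R b)
      \<le> (1 - t) * (put \<nu> a - put \<eta> a) + t * (put \<nu> b - put \<eta> b)"
    using int(2)[OF \<eta>] int(2)[OF \<nu>] unfolding c_def[symmetric] by (simp add: algebra_simps)
qed simp

definition measure_sum :: "real measure \<Rightarrow> real measure \<Rightarrow> real measure" where
  "measure_sum \<eta> \<theta> = measure_of UNIV (sets borel) (\<lambda>A. emeasure \<eta> A + emeasure \<theta> A)"

lemma emeasure_measure_sum:
  assumes "sets \<eta> = sets borel" "sets \<theta> = sets borel" "A \<in> sets borel"
  shows "emeasure (measure_sum \<eta> \<theta>) A = emeasure \<eta> A + emeasure \<theta> A"
  unfolding measure_sum_def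
proof (rule emeasure_measure_of_sigma)
  show "sigma_algebra UNIV (sets (borel :: real measure))"
    using sets.sigma_algebra_axioms[of "borel :: real measure"] by simp
  show "countably_additive (sets borel) (\<lambda>A. emeasure \<eta> A + emeasure \<theta> A)"
    unfolding countably_additive_def
  proof (intro allI impI)
    fix A :: "nat \<Rightarrow> real set"
    assume "range A \<subseteq> sets borel" "disjoint_family A"
    then show "(\<Sum>i. emeasure \<eta> (A i) + emeasure \<theta> (A i)) = emeasure \<eta> (\<Union>i. A i) + emeasure \<theta> (\<Union>i. A i)"
      using assms(1,2) by (subst suminf_add[symmetric]) (auto simp: suminf_emeasure)
  qed
qed (use assms in \<open>auto simp: positive_def\<close>)

lemma sets_measure_sum: "sets (measure_sum \<eta> \<theta>) = sets borel"
  unfolding measure_sum_def by (metis sets.sets_measure_of_eq space_borel)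

text \<open>
  Additivity passes from the potential functions to their right derivatives, the distribution
  functions, and hence to the measures.
\<close>

lemma measure_sum_if_put_sum:
  assumes \<eta>: "\<eta> \<in> first_moment_measures" and \<theta>: "\<theta> \<in> first_moment_measures" and \<nu>: "\<nu> \<in> first_moment_measures"
    and put: "\<And>k. put \<nu> k = put \<eta> k + put \<theta> k"
  shows "\<nu> = measure_sum \<eta> \<theta>"
proof (rule cdf_unique')
  note borel = first_moment_measuresD(3)[OF \<eta>] first_moment_measuresD(3)[OF \<theta>]
  interpret \<eta>: finite_measure \<eta> by (rule first_moment_measuresD[OF \<eta>])
  interpret \<theta>: finite_measure \<theta> by (rule first_moment_measuresD[OF \<theta>])
  have em: "emeasure (measure_sum \<eta> \<theta>) A = ennreal (measure \<eta> A + measure \<theta> A)" if "A \<in> sets borel" for A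
    using emeasure_measure_sum[OF borel that] by (simp add: \<eta>.emeasure_eq_measure \<theta>.emeasure_eq_measure)
  show "finite_borel_measure (measure_sum \<eta> \<theta>)"
    unfolding finite_borel_measure_def finite_borel_measure_axioms_def
    using sets_eq_imp_space_eq[OF sets_measure_sum, of \<eta> \<theta>] sets_measure_sum
    by (auto intro!: finite_measureI simp: em)
  show "finite_borel_measure \<nu>" by (rule first_moment_measuresD[OF \<nu>])
  show "cdf \<nu> = cdf (measure_sum \<eta> \<theta>)"
  proof
    fix x
    have "((\<lambda>y. (put \<eta> y - put \<eta> x) / (y - x) + (put \<theta> y - put \<theta> x) / (y - x))
        \<longlongrightarrow> cdf \<eta> x + cdf \<theta> x) (at_right x)"
      by (intro tendsto_add tendsto_put_slope \<eta> \<theta>)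
    moreover have "(put \<eta> y - put \<eta> x) / (y - x) + (put \<theta> y - put \<theta> x) / (y - x)
        = (put \<nu> y - put \<nu> x) / (y - x)" for y
      by (simp add: put add_divide_distrib[symmetric])
    ultimately have "cdf \<nu> x = cdf \<eta> x + cdf \<theta> x"
      using tendsto_unique[OF trivial_limit_at_right_real tendsto_put_slope[OF \<nu>]] by simp
    then show "cdf \<nu> x = cdf (measure_sum \<eta> \<theta>) x"
      using measure_eq_emeasure_eq_ennreal[OF _ em[of "{..x}"]] by (simp add: cdf_def)
  qed
qed

section \<open>The potential function of the shadow\<close>

lemma is_shadow_unique:
  assumes "is_shadow \<nu> \<mu> \<eta>" "is_shadow \<nu> \<mu> \<eta>'"
  shows "\<eta> = \<eta>'"
proof (rule put_inject)
  have "\<eta> \<in> first_moment_measures" "\<eta>' \<in> first_moment_measures"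
    using assms by (auto simp: is_shadow_def)
  moreover have "convex_order \<eta> \<eta>'" "convex_order \<eta>' \<eta>"
    using assms unfolding is_shadow_def by blast+
  ultimately show "put \<eta> = put \<eta>'"
    by (intro ext antisym convex_orderD(1))
qed (use assms in \<open>auto simp: is_shadow_def\<close>)

text \<open>
  The two bounds come from testing with puts and, by parity, with calls. Together they say that the
  asymptotes of the potential difference \<open>put \<nu> - put \<mu>\<close> at \<open>-\<infinity>\<close> and at \<open>\<infinity>\<close> are affine minorants of
  it.
\<close>

lemma put_diff_bounds:
  assumes \<mu>: "\<mu> \<in> first_moment_measures" and \<nu>: "\<nu> \<in> first_moment_measures" and order: "convex_pos_order \<mu> \<nu>"
  shows "put \<mu> k \<le> put \<nu> k"
    and "k * (measure \<nu> UNIV - measure \<mu> UNIV) - ((\<integral>x. x \<partial>\<nu>) - (\<integral>x. x \<partial>\<mu>)) \<le> put \<nu> k - put \<mu> k"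
proof -
  show "put \<mu> k \<le> put \<nu> k"
    using order convex_on_hinge(1)[of k] linear_growth_hinge(1)[of k]
    by (simp add: convex_pos_order_def put_def)
  have "(\<integral>x. max 0 (x - k) \<partial>\<mu>) \<le> (\<integral>x. max 0 (x - k) \<partial>\<nu>)"
    using order convex_on_hinge(2)[of k] linear_growth_hinge(2)[of k]
    by (simp add: convex_pos_order_def)
  then show "k * (measure \<nu> UNIV - measure \<mu> UNIV) - ((\<integral>x. x \<partial>\<nu>) - (\<integral>x. x \<partial>\<mu>)) \<le> put \<nu> k - put \<mu> k"
    by (simp add: put_call_parity[OF \<mu>] put_call_parity[OF \<nu>] algebra_simps)
qed

text \<open>
  A measure \<open>\<eta>\<close> with the mass and mean of \<open>\<mu>\<close> satisfies \<open>\<mu> \<preceq>\<^sub>C \<eta>\<close> iff \<open>put \<nu> - put \<eta>\<close> is below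
  \<open>D = put \<nu> - put \<mu>\<close>, and \<open>\<eta> \<preceq>\<^sub>+ \<nu>\<close> makes \<open>put \<nu> - put \<eta>\<close> convex. Minimising \<open>\<eta>\<close> therefore means
  maximising a convex function below \<open>D\<close>, so \<open>put \<nu> - put \<eta>\<close> has to be the convex minorant \<open>c\<close> of \<open>D\<close>.
  It remains to see that \<open>c\<close> and \<open>put \<nu> - c\<close> are potential functions of measures \<open>\<theta>\<close> and \<open>\<eta>\<close>, which
  then add up to \<open>\<nu>\<close>. Their convexity is \<open>convex_on_diff_convex_minorant\<close>; they have the correct
  asymptotes because \<open>c\<close> is squeezed between \<open>D\<close> and the asymptotes of \<open>D\<close>.
\<close>

lemma shadow_put:
  assumes \<mu>: "\<mu> \<in> first_moment_measures" and \<nu>: "\<nu> \<in> first_moment_measures" and order: "convex_pos_order \<mu> \<nu>"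
  shows "is_shadow \<nu> \<mu> (shadow \<nu> \<mu>)"
    and "put (shadow \<nu> \<mu>) k = put \<nu> k - convex_minorant (\<lambda>k. put \<nu> k - put \<mu> k) k"
proof -
  define D where "D = (\<lambda>k. put \<nu> k - put \<mu> k)"
  define c where "c = convex_minorant D"
  define d where "d = measure \<nu> UNIV - measure \<mu> UNIV"
  define e where "e = (\<integral>x. x \<partial>\<nu>) - (\<integral>x. x \<partial>\<mu>)"
  have below: "affine_below D 0 0"
    using put_diff_bounds(1)[OF \<mu> \<nu> order] by (simp add: affine_below_def D_def)
  have below': "affine_below D d (- e)"
    unfolding affine_below_def
  proof
    fix t show "d * t + - e \<le> D t"
      using put_diff_bounds(2)[OF \<mu> \<nu> order, of t] unfolding d_def[symmetric] e_def[symmetric]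
      by (simp add: D_def mult.commute)
  qed
  have cD: "c k \<le> D k" for k unfolding c_def by (rule convex_minorant_le[OF below])
  have c0: "0 \<le> c k" and ce: "k * d - e \<le> c k" for k
    using affine_le_convex_minorant[OF below, of k] affine_le_convex_minorant[OF below', of k]
    by (simp_all add: c_def mult.commute)
  have cconv: "convex_on UNIV c" unfolding c_def by (rule convex_on_convex_minorant[OF below])
  have Uconv: "convex_on UNIV (\<lambda>k. put \<nu> k - c k)"
    using convex_on_diff_convex_minorant[OF convex_on_put[OF \<mu>] convex_on_put[OF \<nu>] below[unfolded D_def]]
    by (simp add: c_def D_def)
  have D_bot: "(D \<longlongrightarrow> 0) at_bot"
    using tendsto_diff[OF tendsto_put_at_bot[OF \<nu>] tendsto_put_at_bot[OF \<mu>]] by (simp add: D_def)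
  have D_top: "((\<lambda>k. D k - (k * d - e)) \<longlongrightarrow> 0) at_top"
    using tendsto_diff[OF tendsto_put_at_top[OF \<nu>] tendsto_put_at_top[OF \<mu>]]
    by (simp add: D_def d_def e_def algebra_simps)
  have c_bot: "(c \<longlongrightarrow> 0) at_bot"
    by (rule tendsto_sandwich[OF _ _ tendsto_const D_bot]) (use c0 cD in auto)
  have c_top: "((\<lambda>k. c k - (k * d - e)) \<longlongrightarrow> 0) at_top"
    by (rule tendsto_sandwich[OF _ _ tendsto_const D_top]) (use ce cD in auto)
  obtain \<theta> where \<theta>: "\<theta> \<in> first_moment_measures" "put \<theta> = c"
    using measure_with_put[OF cconv c_bot c_top] by blast
  have "((\<lambda>k. put \<nu> k - c k) \<longlongrightarrow> 0) at_bot"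
    using tendsto_diff[OF tendsto_put_at_bot[OF \<nu>] c_bot] by simp
  moreover have "((\<lambda>k. (put \<nu> k - c k) - (k * measure \<mu> UNIV - (\<integral>x. x \<partial>\<mu>))) \<longlongrightarrow> 0) at_top"
    using tendsto_diff[OF tendsto_put_at_top[OF \<nu>] c_top] by (simp add: d_def e_def algebra_simps)
  ultimately obtain \<eta> where \<eta>: "\<eta> \<in> first_moment_measures" "put \<eta> = (\<lambda>k. put \<nu> k - c k)"
      "measure \<eta> UNIV = measure \<mu> UNIV" "(\<integral>x. x \<partial>\<eta>) = (\<integral>x. x \<partial>\<mu>)"
    using measure_with_put[OF Uconv] by blast
  have "\<nu> = measure_sum \<eta> \<theta>"
    by (rule measure_sum_if_put_sum[OF \<eta>(1) \<theta>(1) \<nu>]) (simp add: \<eta>(2) \<theta>(2))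
  then have set: "setwise_order \<eta> \<nu>"
    unfolding setwise_order_def
    using emeasure_measure_sum[of \<eta> \<theta>] first_moment_measuresD(3) \<eta>(1) \<theta>(1) by simp
  have conv: "convex_order \<mu> \<eta>"
    unfolding convex_order_iff_put_le[OF \<mu> \<eta>(1)] using \<eta> cD by (simp add: D_def algebra_simps)
  have least: "convex_order \<eta> \<eta>'" if \<eta>': "\<eta>' \<in> first_moment_measures" and le: "convex_order \<mu> \<eta>'" "setwise_order \<eta>' \<nu>" for \<eta>'
  proof -
    note fromle = convex_orderD[OF le(1) \<mu> \<eta>']
    have "put \<nu> k - put \<eta>' k \<le> c k" for k
      unfolding c_def
      by (rule convex_le_convex_minorant[OF convex_on_put_diff[OF \<eta>' \<nu> le(2)]]) (simp add: D_def fromle(1))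
    then show ?thesis
      unfolding convex_order_iff_put_le[OF \<eta>(1) \<eta>'] using \<eta> fromle by (simp add: algebra_simps)
  qed
  have sh: "is_shadow \<nu> \<mu> \<eta>"
    unfolding is_shadow_def using \<eta>(1) conv set least by blast
  then have eq: "shadow \<nu> \<mu> = \<eta>"
    unfolding shadow_def using is_shadow_unique by blast
  show "is_shadow \<nu> \<mu> (shadow \<nu> \<mu>)" using sh eq by simp
  show "put (shadow \<nu> \<mu>) k = put \<nu> k - convex_minorant (\<lambda>k. put \<nu> k - put \<mu> k) k"
    by (simp add: eq \<eta>(2) c_def D_def)
qed

section \<open>Stability of the shadow\<close>

theorem theorem2p30:
  fixes \<mu> \<mu>' \<nu> \<nu>' :: "real measure"
  assumes "\<mu> \<in> first_moment_measures" and "\<mu>' \<in> first_moment_measures"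
    and "\<nu> \<in> first_moment_measures" and "\<nu>' \<in> first_moment_measures"
    and "convex_pos_order \<mu> \<nu>" and "convex_pos_order \<mu>' \<nu>'"
    and "measure \<mu> UNIV = measure \<mu>' UNIV" and "measure \<nu> UNIV = measure \<nu>' UNIV"
  shows "kantorovich (shadow \<nu> \<mu>) (shadow \<nu>' \<mu>') \<le> kantorovich \<mu> \<mu>' + 2 * kantorovich \<nu> \<nu>'"
proof -
  let ?D = "\<lambda>k. put \<nu> k - put \<mu> k" and ?D' = "\<lambda>k. put \<nu>' k - put \<mu>' k"
  have sh: "shadow \<nu> \<mu> \<in> first_moment_measures" "convex_order \<mu> (shadow \<nu> \<mu>)"
    and sh': "shadow \<nu>' \<mu>' \<in> first_moment_measures" "convex_order \<mu>' (shadow \<nu>' \<mu>')"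
    using shadow_put(1)[OF assms(1,3,5)] shadow_put(1)[OF assms(2,4,6)] by (simp_all add: is_shadow_def)
  have mass: "measure (shadow \<nu> \<mu>) UNIV = measure (shadow \<nu>' \<mu>') UNIV"
    using convex_orderD(2)[OF sh(2) assms(1) sh(1)] convex_orderD(2)[OF sh'(2) assms(2) sh'(1)] assms(7) by simp
  have below: "affine_below ?D 0 0" "affine_below ?D' 0 0"
    using put_diff_bounds(1)[OF assms(1,3,5)] put_diff_bounds(1)[OF assms(2,4,6)]
    by (simp_all add: affine_below_def)
  have var: "variation_le (\<lambda>k. put \<nu> k - put \<nu>' k) (kantorovich \<nu> \<nu>')"
    by (rule variation_le_kantorovich[OF assms(3,4,8)])
  have "variation_le (\<lambda>k. ?D k - ?D' k) (kantorovich \<nu> \<nu>' + kantorovich \<mu> \<mu>')"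
    using variation_le_diff[OF var variation_le_kantorovich[OF assms(1,2,7)]] by (simp add: algebra_simps)
  from variation_le_diff[OF var variation_le_convex_minorant[OF below this]]
  have "variation_le (\<lambda>k. put (shadow \<nu> \<mu>) k - put (shadow \<nu>' \<mu>') k)
      (kantorovich \<nu> \<nu>' + (kantorovich \<nu> \<nu>' + kantorovich \<mu> \<mu>'))"
    by (simp add: shadow_put(2)[OF assms(1,3,5)] shadow_put(2)[OF assms(2,4,6)] algebra_simps)
  from kantorovich_le_variation[OF sh(1) sh'(1) mass this] show ?thesis by simp
qed

end
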